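(* (a) Let $(A,\circ,[\cdot,\cdot])$ be a Gel'fand-Dorfman algebra, $(V,l_A,r_A,\rho_A)$ a representation of it, and $T:V\to A$ an $\mathcal{O}$-operator associated to $(V,l_A,r_A,\rho_A)$. Then there exists a pre-Gel'fand-Dorfman algebra structure $(V,\lhd,\rhd,\diamond)$ on $V$ defined by $$u\rhd v=l_A(T(u))v,\quad u\lhd v=r_A(T(v))u,\quad u\diamond v=\rho_A(T(u))v,\qquad u,v\in V.$$ (b) Let $(A,\lhd,\rhd,\diamond)$ be a pre-Gel'fand-Dorfman algebra and $(A,\circ,[\cdot,\cdot])$ its associated Gel'fand-Dorfman algebra. Then the identity map of $A$ is an $\mathcal{O}$-operator on $(A,\circ,[\cdot,\cdot])$ associated to the representation $(A,L_\rhd,R_\lhd,L_\diamond)$. (c) Let $(A,\lhd,\rhd,\diamond)$ be a pre-Gel'fand-Dorfman algebra and $(A,\circ,[\cdot,\cdot])$ its associated Gel'fand-Dorfman algebra. Let $\{e_1,\ldots,e_n\}$ be a linear basis of $A$ and $\{e_1^\ast,\ldots,e_n^\ast\}$ the dual basis of $A^\ast$. Then $$r=\sum_{\alpha=1}^n(e_\alpha\otimes e_\alpha^\ast-e_\alpha^\ast\otimes e_\alpha)$$ is a skew-symmetric solution of the Gel'fand-Dorfman Yang-Baxter equation in the Gel'fand-Dorfman algebra $A\ltimes_{L_\rhd^\ast+R_\lhd^\ast,-R_\lhd^\ast,L_\diamond^\ast}A^\ast$.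
   Context: Conventions: $\mathbf{k}$ is a field of characteristic $0$; vector spaces over $\mathbf{k}$ are finite-dimensional; $\otimes=\otimes_{\mathbf{k}}$; $\tau(a\otimes b)=b\otimes a$; $a\star b=a\circ b+b\circ a$. For a binary operation $\ast$ write $L_\ast(a)b=a\ast b$, $R_\ast(a)b=b\ast a$. Skew-symmetric means $r+\tau r=0$. A Novikov algebra $(A,\circ)$ satisfies $(a\circ b)\circ c-a\circ(b\circ c)=(b\circ a)\circ c-b\circ(a\circ c)$ and $(a\circ b)\circ c=(a\circ c)\circ b$; a left-symmetric algebra satisfies only the first identity. A Gel'fand-Dorfman (GD) algebra $(A,\circ,[\cdot,\cdot])$ is a Novikov algebra $(A,\circ)$ and a Lie algebra $(A,[\cdot,\cdot])$ with $[a\circ b,c]-[a\circ c,b]+[a,b]\circ c-[a,c]\circ b-a\circ[b,c]=0$ for all $a,b,c$. A representation $(V,l_A,r_A,\rho_A)$ of a GD algebra $A$: $l_A,r_A,\rho_A:A\to\mathrm{End}_{\mathbf{k}}(V)$ linear, $\rho_A$ a representation of the Lie algebra $(A,[\cdot,\cdot])$, and for all $a,b\in A$, $v\in V$: $l_A(a\circ b-b\circ a)v=l_A(a)l_A(b)v-l_A(b)l_A(a)v$; $l_A(a)r_A(b)v-r_A(b)l_A(a)v=r_A(a\circ b)v-r_A(b)r_A(a)v$; $l_A(a\circ b)v=r_A(b)l_A(a)v$; $r_A(a)r_A(b)v=r_A(b)r_A(a)v$; $\rho_A(a)l_A(b)v+\rho_A(b\circ a)v+l_A([b,a])v-r_A(a)\rho_A(b)v-l_A(b)\rho_A(a)v=0$;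 $\rho_A(a)r_A(b)v-\rho_A(b)r_A(a)v-r_A(b)\rho_A(a)v+r_A(a)\rho_A(b)v-r_A([a,b])v=0$. For a linear map $\varphi:A\to\mathrm{End}_{\mathbf{k}}(V)$, $\varphi^\ast:A\to\mathrm{End}_{\mathbf{k}}(V^\ast)$ is $\langle\varphi^\ast(a)f,u\rangle=-\langle f,\varphi(a)u\rangle$. If $(V,l_A,r_A,\rho_A)$ is a representation of $A$, then so is $(V^\ast,l_A^\ast+r_A^\ast,-r_A^\ast,\rho_A^\ast)$. For a representation $(W,l,r,\rho)$ of $A$, the semi-direct product $A\ltimes_{l,r,\rho}W$ is the GD algebra on $A\oplus W$ with $(a+u)\bullet(b+v)=a\circ b+l(a)v+r(b)u$ and $[a+u,b+v]=[a,b]+\rho(a)v-\rho(b)u$. A linear map $T:V\to A$ is an $\mathcal{O}$-operator on $(A,\circ,[\cdot,\cdot])$ associated to $(V,l_A,r_A,\rho_A)$ if $T(u)\circ T(v)=T(l_A(T(u))v+r_A(T(v))u)$ and $[T(u),T(v)]=T(\rho_A(T(u))v-\rho_A(T(v))u)$ for all $u,v\in V$. A pre-Novikov algebra $(A,\lhd,\rhd)$ satisfies, for all $a,b,c$: $a\rhd(b\rhd c)=(a\rhd b+a\lhd b)\rhd c+b\rhd(a\rhd c)-(b\rhd a+b\lhd a)\rhd c$; $a\rhd(b\lhd c)=(a\rhd b)\lhd c+b\lhd(a\lhd c+a\rhd c)-(b\lhd a)\lhd c$; $(a\lhd b+a\rhd b)\rhd c=(a\rhd c)\lhd b$; $(a\lhd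 b)\lhd c=(a\lhd c)\lhd b$. A pre-Gel'fand-Dorfman (pre-GD) algebra $(A,\lhd,\rhd,\diamond)$ is a pre-Novikov algebra $(A,\lhd,\rhd)$ and a left-symmetric algebra $(A,\diamond)$ with $c\lhd(a\diamond b-b\diamond a)-a\diamond(c\lhd b)-(b\diamond c)\lhd a=-b\diamond(c\lhd a)-(a\diamond c)\lhd b$ and $(a\diamond b-b\diamond a)\rhd c+(a\lhd b+a\rhd b)\diamond c=a\rhd(b\diamond c)-b\diamond(a\rhd c)+(a\diamond c)\lhd b$. Its associated GD algebra is $A$ with $a\circ b=a\lhd b+a\rhd b$, $[a,b]=a\diamond b-b\diamond a$; $(A,L_\rhd,R_\lhd,L_\diamond)$ is a representation of the associated GD algebra. The Gel'fand-Dorfman Yang-Baxter equation (GDYBE) in a GD algebra $(B,\circ,[\cdot,\cdot])$ for $r=\sum_\alpha x_\alpha\otimes y_\alpha\in B\otimes B$ is $\mathbf{N}(r)=\mathbf{C}(r)=0$, where $\mathbf{N}(r)=\sum_{\alpha,\beta}\big(x_\alpha\otimes x_\beta\otimes y_\alpha\circ y_\beta+x_\alpha\otimes y_\alpha\star x_\beta\otimes y_\beta+x_\alpha\circ x_\beta\otimes y_\beta\otimes y_\alpha\big)$, $\mathbf{C}(r)=\sum_{\alpha,\beta}\big([x_\alpha,x_\beta]\otimes y_\alpha\otimes y_\beta+x_\alpha\otimes[y_\alpha,x_\beta]\otimes y_\beta+x_\alpha\otimes x_\beta\otimes[y_\alpha,y_\beta]\big)$. *)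

theory Defs
  imports
    Complex_Main
    "HOL-Library.Function_Algebras"
    "HOL-Library.Product_Plus"
    "HOL-Library.Poly_Mapping"
begin

section \<open>Algebras\<close>

text \<open>
  The space underlying an algebra is a finite-dimensional subspace \<open>B\<close> of an ambient vector
  space. The carrier is needed because the dual of a space is not a type but a set of functions;
  an algebra on a whole type has the carrier \<open>UNIV\<close>.
\<close>

locale fd_space = vector_space scale
  for scale :: "'k::field_char_0 \<Rightarrow> 'b::ab_group_add \<Rightarrow> 'b" +
  fixes B :: "'b set"
  assumes finite_dimensional: "\<exists>S. finite S \<and> span S = B"

locale bilinear_algebra = fd_space scale B
  for scale :: "'k::field_char_0 \<Rightarrow> 'b::ab_group_add \<Rightarrow> 'b" and B +
  fixes mult :: "'b \<Rightarrow> 'b \<Rightarrow> 'b"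
  assumes mult_closed: "\<lbrakk>a \<in> B; b \<in> B\<rbrakk> \<Longrightarrow> mult a b \<in> B"
    and mult_add_left: "\<lbrakk>a \<in> B; a' \<in> B; b \<in> B\<rbrakk> \<Longrightarrow> mult (a + a') b = mult a b + mult a' b"
    and mult_add_right: "\<lbrakk>a \<in> B; b \<in> B; b' \<in> B\<rbrakk> \<Longrightarrow> mult a (b + b') = mult a b + mult a b'"
    and mult_scale_left: "\<lbrakk>a \<in> B; b \<in> B\<rbrakk> \<Longrightarrow> mult (scale c a) b = scale c (mult a b)"
    and mult_scale_right: "\<lbrakk>a \<in> B; b \<in> B\<rbrakk> \<Longrightarrow> mult a (scale c b) = scale c (mult a b)"

locale left_symmetric_algebra = bilinear_algebra scale B mult
  for scale :: "'k::field_char_0 \<Rightarrow> 'b::ab_group_add \<Rightarrow> 'b" and B and mult +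
  assumes left_symmetric: "\<lbrakk>a \<in> B; b \<in> B; c \<in> B\<rbrakk> \<Longrightarrow>
    mult (mult a b) c - mult a (mult b c) = mult (mult b a) c - mult b (mult a c)"

locale novikov_algebra = left_symmetric_algebra scale B mult
  for scale :: "'k::field_char_0 \<Rightarrow> 'b::ab_group_add \<Rightarrow> 'b" and B and mult +
  assumes right_commutative: "\<lbrakk>a \<in> B; b \<in> B; c \<in> B\<rbrakk> \<Longrightarrow>
    mult (mult a b) c = mult (mult a c) b"

locale lie_algebra = bilinear_algebra scale B bracket
  for scale :: "'k::field_char_0 \<Rightarrow> 'b::ab_group_add \<Rightarrow> 'b" and B and bracket +
  assumes alternating: "a \<in> B \<Longrightarrow> bracket a a = 0"
    and jacobi: "\<lbrakk>a \<in> B; b \<in> B; c \<in> B\<rbrakk> \<Longrightarrow>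
      bracket a (bracket b c) + bracket b (bracket c a) + bracket c (bracket a b) = 0"

locale GD_algebra =
  novikov: novikov_algebra scale B circ + lie: lie_algebra scale B bracket
  for scale :: "'k::field_char_0 \<Rightarrow> 'b::ab_group_add \<Rightarrow> 'b" and B and circ and bracket +
  assumes GD_compatible: "\<lbrakk>a \<in> B; b \<in> B; c \<in> B\<rbrakk> \<Longrightarrow>
    bracket (circ a b) c - bracket (circ a c) b + circ (bracket a b) c - circ (bracket a c) b
      - circ a (bracket b c) = 0"

locale pre_novikov_algebra =
  lhd: bilinear_algebra scale B lhd + rhd: bilinear_algebra scale B rhd
  for scale :: "'k::field_char_0 \<Rightarrow> 'b::ab_group_add \<Rightarrow> 'b" and B
    and lhd :: "'b \<Rightarrow> 'b \<Rightarrow> 'b" (infixl \<open>\<lhd>\<close> 70)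
    and rhd :: "'b \<Rightarrow> 'b \<Rightarrow> 'b" (infixl \<open>\<rhd>\<close> 70) +
  assumes pre_novikov1: "\<lbrakk>a \<in> B; b \<in> B; c \<in> B\<rbrakk> \<Longrightarrow>
      a \<rhd> (b \<rhd> c) = (a \<rhd> b + a \<lhd> b) \<rhd> c + b \<rhd> (a \<rhd> c) - (b \<rhd> a + b \<lhd> a) \<rhd> c"
    and pre_novikov2: "\<lbrakk>a \<in> B; b \<in> B; c \<in> B\<rbrakk> \<Longrightarrow>
      a \<rhd> (b \<lhd> c) = (a \<rhd> b) \<lhd> c + b \<lhd> (a \<lhd> c + a \<rhd> c) - (b \<lhd> a) \<lhd> c"
    and pre_novikov3: "\<lbrakk>a \<in> B; b \<in> B; c \<in> B\<rbrakk> \<Longrightarrow>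
      (a \<lhd> b + a \<rhd> b) \<rhd> c = (a \<rhd> c) \<lhd> b"
    and pre_novikov4: "\<lbrakk>a \<in> B; b \<in> B; c \<in> B\<rbrakk> \<Longrightarrow>
      (a \<lhd> b) \<lhd> c = (a \<lhd> c) \<lhd> b"

locale pre_GD_algebra =
  pre_novikov_algebra scale B lhd rhd + dia: left_symmetric_algebra scale B dia
  for scale :: "'k::field_char_0 \<Rightarrow> 'b::ab_group_add \<Rightarrow> 'b" and B
    and lhd (infixl \<open>\<lhd>\<close> 70) and rhd (infixl \<open>\<rhd>\<close> 70) and dia (infixl \<open>\<diamondop>\<close> 70) +
  assumes pre_GD1: "\<lbrakk>a \<in> B; b \<in> B; c \<in> B\<rbrakk> \<Longrightarrow>
      c \<lhd> (a \<diamondop> b - b \<diamondop> a) - a \<diamondop> (c \<lhd> b) - (b \<diamondop> c) \<lhd> a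
        = - (b \<diamondop> (c \<lhd> a)) - (a \<diamondop> c) \<lhd> b"
    and pre_GD2: "\<lbrakk>a \<in> B; b \<in> B; c \<in> B\<rbrakk> \<Longrightarrow>
      (a \<diamondop> b - b \<diamondop> a) \<rhd> c + (a \<lhd> b + a \<rhd> b) \<diamondop> c
        = a \<rhd> (b \<diamondop> c) - b \<diamondop> (a \<rhd> c) + (a \<diamondop> c) \<lhd> b"

definition assoc_circ :: "('a \<Rightarrow> 'a \<Rightarrow> 'a::ab_group_add) \<Rightarrow> ('a \<Rightarrow> 'a \<Rightarrow> 'a) \<Rightarrow> 'a \<Rightarrow> 'a \<Rightarrow> 'a" where
  "assoc_circ lhd rhd a b = lhd a b + rhd a b"

definition assoc_bracket :: "('a \<Rightarrow> 'a \<Rightarrow> 'a::ab_group_add) \<Rightarrow> 'a \<Rightarrow> 'a \<Rightarrow> 'a" where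
  "assoc_bracket dia a b = dia a b - dia b a"

definition left_mult :: "('a \<Rightarrow> 'a \<Rightarrow> 'a) \<Rightarrow> 'a \<Rightarrow> 'a \<Rightarrow> 'a" where
  "left_mult m a b = m a b"

definition right_mult :: "('a \<Rightarrow> 'a \<Rightarrow> 'a) \<Rightarrow> 'a \<Rightarrow> 'a \<Rightarrow> 'a" where
  "right_mult m a b = m b a"


section \<open>Representations and O-operators\<close>

text \<open>\<open>linear_action sA sV \<phi>\<close>: \<open>\<phi>\<close> is a linear map from \<open>A\<close> to \<open>End V\<close>.\<close>

definition linear_action ::
  "('k::field_char_0 \<Rightarrow> 'a::ab_group_add \<Rightarrow> 'a) \<Rightarrow> ('k \<Rightarrow> 'v::ab_group_add \<Rightarrow> 'v) \<Rightarrow> ('a \<Rightarrow> 'v \<Rightarrow> 'v) \<Rightarrow> bool"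
where
  "linear_action sA sV \<phi> \<longleftrightarrow>
    (\<forall>a. Vector_Spaces.linear sV sV (\<phi> a)) \<and> (\<forall>v. Vector_Spaces.linear sA sV (\<lambda>a. \<phi> a v))"

locale GD_representation =
  GD_algebra sA UNIV circ bracket + V: fd_space sV UNIV
  for sA :: "'k::field_char_0 \<Rightarrow> 'a::ab_group_add \<Rightarrow> 'a"
    and circ (infixl \<open>\<circ>\<^sub>A\<close> 70) and bracket (\<open>[_,_]\<^sub>A\<close>)
    and sV :: "'k \<Rightarrow> 'v::ab_group_add \<Rightarrow> 'v" +
  fixes l r \<rho> :: "'a \<Rightarrow> 'v \<Rightarrow> 'v"
  assumes linear_l: "linear_action sA sV l"
    and linear_r: "linear_action sA sV r"
    and linear_\<rho>: "linear_action sA sV \<rho>"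
    and lie_rep: "\<rho> [a,b]\<^sub>A v = \<rho> a (\<rho> b v) - \<rho> b (\<rho> a v)"
    and rep1: "l (a \<circ>\<^sub>A b - b \<circ>\<^sub>A a) v = l a (l b v) - l b (l a v)"
    and rep2: "l a (r b v) - r b (l a v) = r (a \<circ>\<^sub>A b) v - r b (r a v)"
    and rep3: "l (a \<circ>\<^sub>A b) v = r b (l a v)"
    and rep4: "r a (r b v) = r b (r a v)"
    and rep5: "\<rho> a (l b v) + \<rho> (b \<circ>\<^sub>A a) v + l [b,a]\<^sub>A v - r a (\<rho> b v) - l b (\<rho> a v) = 0"
    and rep6: "\<rho> a (r b v) - \<rho> b (r a v) - r b (\<rho> a v) + r a (\<rho> b v) - r [a,b]\<^sub>A v = 0"

locale O_operator = GD_representation sA circ bracket sV l r \<rho>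
  for sA :: "'k::field_char_0 \<Rightarrow> 'a::ab_group_add \<Rightarrow> 'a"
    and circ (infixl \<open>\<circ>\<^sub>A\<close> 70) and bracket (\<open>[_,_]\<^sub>A\<close>)
    and sV :: "'k \<Rightarrow> 'v::ab_group_add \<Rightarrow> 'v" and l r \<rho> +
  fixes T :: "'v \<Rightarrow> 'a"
  assumes linear_T: "Vector_Spaces.linear sV sA T"
    and O_circ: "T u \<circ>\<^sub>A T v = T (l (T u) v + r (T v) u)"
    and O_bracket: "[T u, T v]\<^sub>A = T (\<rho> (T u) v - \<rho> (T v) u)"


section \<open>Dual space and semi-direct product\<close>

definition dual_space :: "('k::field_char_0 \<Rightarrow> 'a::ab_group_add \<Rightarrow> 'a) \<Rightarrow> ('a \<Rightarrow> 'k) set" where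
  "dual_space sA = {f. Vector_Spaces.linear sA (*) f}"

definition dual_scale :: "'k::field_char_0 \<Rightarrow> ('a \<Rightarrow> 'k) \<Rightarrow> ('a \<Rightarrow> 'k)" where
  "dual_scale c f = (\<lambda>u. c * f u)"

definition dual_action :: "('a \<Rightarrow> 'v \<Rightarrow> 'v) \<Rightarrow> 'a \<Rightarrow> ('v \<Rightarrow> 'k::field_char_0) \<Rightarrow> ('v \<Rightarrow> 'k)" where
  "dual_action \<phi> a f = (\<lambda>u. - f (\<phi> a u))"

definition sum_scale ::
  "('k \<Rightarrow> 'a \<Rightarrow> 'a) \<Rightarrow> ('k \<Rightarrow> 'w \<Rightarrow> 'w) \<Rightarrow> 'k \<Rightarrow> 'a \<times> 'w \<Rightarrow> 'a \<times> 'w"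
where
  "sum_scale sA sW c = (\<lambda>(a, u). (sA c a, sW c u))"

definition semidirect_circ ::
  "('a \<Rightarrow> 'a \<Rightarrow> 'a) \<Rightarrow> ('a \<Rightarrow> 'w \<Rightarrow> 'w) \<Rightarrow> ('a \<Rightarrow> 'w \<Rightarrow> 'w::ab_group_add) \<Rightarrow> 'a \<times> 'w \<Rightarrow> 'a \<times> 'w \<Rightarrow> 'a \<times> 'w"
where
  "semidirect_circ circ l r = (\<lambda>(a, u) (b, v). (circ a b, l a v + r b u))"

definition semidirect_bracket ::
  "('a \<Rightarrow> 'a \<Rightarrow> 'a) \<Rightarrow> ('a \<Rightarrow> 'w \<Rightarrow> 'w::ab_group_add) \<Rightarrow> 'a \<times> 'w \<Rightarrow> 'a \<times> 'w \<Rightarrow> 'a \<times> 'w"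
where
  "semidirect_bracket bracket \<rho> = (\<lambda>(a, u) (b, v). (bracket a b, \<rho> a v - \<rho> b u))"


section \<open>Tensor powers\<close>

text \<open>
  The tensor power of \<open>n\<close> copies of \<open>B\<close> is the quotient of the free vector space on the
  \<open>n\<close>-tuples over \<open>B\<close> (lists of length \<open>n\<close>) by the subspace spanned by the multilinearity
  relations. The relations depend on the scalar multiplication, so the quotient cannot be a type:
  a tensor is given by a representative in the free space, and two tensors are equal iff their
  difference lies in \<open>tensor_null\<close>.
\<close>

definition tensor_scale :: "'k::field_char_0 \<Rightarrow> ('b list \<Rightarrow>\<^sub>0 'k) \<Rightarrow> ('b list \<Rightarrow>\<^sub>0 'k)" where
  "tensor_scale c = Poly_Mapping.map ((*) c)"

definition pure_tensor :: "'b list \<Rightarrow> ('b list \<Rightarrow>\<^sub>0 'k::field_char_0)" where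
  "pure_tensor xs = Poly_Mapping.single xs 1"

definition tensor_rep :: "'b set \<Rightarrow> nat \<Rightarrow> ('b list \<Rightarrow>\<^sub>0 'k::field_char_0) set" where
  "tensor_rep B n = {t. \<forall>xs \<in> Poly_Mapping.keys t. length xs = n \<and> set xs \<subseteq> B}"

definition tensor_relations ::
  "('k::field_char_0 \<Rightarrow> 'b::ab_group_add \<Rightarrow> 'b) \<Rightarrow> 'b set \<Rightarrow> nat \<Rightarrow> ('b list \<Rightarrow>\<^sub>0 'k) set"
where
  "tensor_relations scale B n =
    {pure_tensor (us @ (x + y) # vs) - pure_tensor (us @ x # vs) - pure_tensor (us @ y # vs) | us x y vs.
      x \<in> B \<and> y \<in> B \<and> set us \<subseteq> B \<and> set vs \<subseteq> B \<and> length us + 1 + length vs = n} \<union>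
    {pure_tensor (us @ scale c x # vs) - tensor_scale c (pure_tensor (us @ x # vs)) | us c x vs.
      x \<in> B \<and> set us \<subseteq> B \<and> set vs \<subseteq> B \<and> length us + 1 + length vs = n}"

definition tensor_null ::
  "('k::field_char_0 \<Rightarrow> 'b::ab_group_add \<Rightarrow> 'b) \<Rightarrow> 'b set \<Rightarrow> nat \<Rightarrow> ('b list \<Rightarrow>\<^sub>0 'k) set"
where
  "tensor_null scale B n = module.span tensor_scale (tensor_relations scale B n)"

definition flip :: "('b list \<Rightarrow>\<^sub>0 'k::field_char_0) \<Rightarrow> ('b list \<Rightarrow>\<^sub>0 'k)" where
  "flip t = (\<Sum>p\<in>Poly_Mapping.keys t.
      tensor_scale (Poly_Mapping.lookup t p) (pure_tensor [p ! 1, p ! 0]))"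

definition skew_symmetric ::
  "('k::field_char_0 \<Rightarrow> 'b::ab_group_add \<Rightarrow> 'b) \<Rightarrow> 'b set \<Rightarrow> ('b list \<Rightarrow>\<^sub>0 'k) \<Rightarrow> bool"
where
  "skew_symmetric scale B t \<longleftrightarrow> t \<in> tensor_rep B 2 \<and> t + flip t \<in> tensor_null scale B 2"


section \<open>The Gel'fand-Dorfman Yang-Baxter equation\<close>

text \<open>
  For \<open>t = (\<Sum>\<alpha>. x\<^sub>\<alpha> \<otimes> y\<^sub>\<alpha>)\<close> this is \<open>\<Sum>\<alpha> \<beta>. F x\<^sub>\<alpha> y\<^sub>\<alpha> x\<^sub>\<beta> y\<^sub>\<beta>\<close>, where the coefficients of the
  representative \<open>t\<close> are taken out by bilinearity.
\<close>

definition double_sum ::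
  "('b \<Rightarrow> 'b \<Rightarrow> 'b \<Rightarrow> 'b \<Rightarrow> ('b list \<Rightarrow>\<^sub>0 'k::field_char_0)) \<Rightarrow> ('b list \<Rightarrow>\<^sub>0 'k) \<Rightarrow> ('b list \<Rightarrow>\<^sub>0 'k)"
where
  "double_sum F t = (\<Sum>p\<in>Poly_Mapping.keys t. \<Sum>q\<in>Poly_Mapping.keys t.
      tensor_scale (Poly_Mapping.lookup t p * Poly_Mapping.lookup t q)
        (F (p ! 0) (p ! 1) (q ! 0) (q ! 1)))"

definition GDYB_N ::
  "('b \<Rightarrow> 'b \<Rightarrow> 'b::ab_group_add) \<Rightarrow> ('b list \<Rightarrow>\<^sub>0 'k::field_char_0) \<Rightarrow> ('b list \<Rightarrow>\<^sub>0 'k)"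
where
  "GDYB_N circ = double_sum (\<lambda>x y x' y'.
      pure_tensor [x, x', circ y y'] + pure_tensor [x, circ y x' + circ x' y, y']
        + pure_tensor [circ x x', y', y])"

definition GDYB_C ::
  "('b \<Rightarrow> 'b \<Rightarrow> 'b::ab_group_add) \<Rightarrow> ('b list \<Rightarrow>\<^sub>0 'k::field_char_0) \<Rightarrow> ('b list \<Rightarrow>\<^sub>0 'k)"
where
  "GDYB_C bracket = double_sum (\<lambda>x y x' y'.
      pure_tensor [bracket x x', y, y'] + pure_tensor [x, bracket y x', y']
        + pure_tensor [x, x', bracket y y'])"

definition GDYBE_solution ::
  "('k::field_char_0 \<Rightarrow> 'b::ab_group_add \<Rightarrow> 'b) \<Rightarrow> 'b set \<Rightarrow> ('b \<Rightarrow> 'b \<Rightarrow> 'b) \<Rightarrow> ('b \<Rightarrow> 'b \<Rightarrow> 'b)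
    \<Rightarrow> ('b list \<Rightarrow>\<^sub>0 'k) \<Rightarrow> bool"
where
  "GDYBE_solution scale B circ bracket t \<longleftrightarrow>
    GD_algebra scale B circ bracket \<and> t \<in> tensor_rep B 2 \<and>
    GDYB_N circ t \<in> tensor_null scale B 3 \<and> GDYB_C bracket t \<in> tensor_null scale B 3"

end

theory Submission
  imports Defs
begin

text \<open>
  The first two claims are two readings of the same identities. Substituting \<open>T u\<close>, \<open>T v\<close> for the
  algebra elements in the axioms of a representation and using that \<open>T\<close> carries
  \<open>l (T u) v + r (T v) u\<close> to \<open>T u \<circ> T v\<close> and \<open>\<rho> (T u) v - \<rho> (T v) u\<close> to \<open>[T u, T v]\<close> gives the
  axioms of a pre-Gel'fand-Dorfman algebra on \<open>V\<close> (\<open>pre_GD_algebra_O_operator\<close>). Conversely, the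
  axioms of a pre-Gel'fand-Dorfman algebra say that \<open>L\<^sub>\<rhd>\<close>, \<open>R\<^sub>\<lhd>\<close>, \<open>L\<^sub>\<diamondop>\<close> represent the associated
  algebra (\<open>GD_algebra_associated\<close>, \<open>GD_representation_pre_GD\<close>), and the O-operator identities for
  the identity map are the definitions of the associated operations (\<open>O_operator_id\<close>).

  The third claim requires first that the semi-direct product with the dual representation is a
  Gel'fand-Dorfman algebra (\<open>dual_representation\<close>, \<open>GD_algebra_semidirect\<close>). For the Yang-Baxter
  equation, a tensor is zero as soon as every linear functional that respects the multilinearity
  relations vanishes on it (\<open>in_span_if_annihilated\<close>), so the equation becomes a family of scalar
  identities for a trilinear form on \<open>A \<oplus> A\<^sup>*\<close>. Expanded over the dual bases, each nonzero term has one
  vector and two covectors as arguments. The key is that an operator can be moved across the canonical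
  element, \<open>\<Sum>\<alpha>. e\<^sub>\<alpha> \<otimes> \<phi>\<^sup>* e'\<^sub>\<alpha> = - (\<Sum>\<alpha>. \<phi> e\<^sub>\<alpha> \<otimes> e'\<^sub>\<alpha>)\<close> (\<open>trace_shift\<close>): afterwards
  all operators act on basis vectors, the covectors are \<open>e'\<^sub>\<alpha>\<close> and \<open>e'\<^sub>\<beta>\<close>, and the terms with the vector
  in a given slot cancel, because \<open>\<circ> = \<lhd> + \<rhd>\<close> and the bracket is the commutator of \<open>\<diamondop>\<close>
  (\<open>form_GDYB_N\<close>, \<open>form_GDYB_C\<close>).
\<close>

section \<open>The associated Gel'fand-Dorfman algebra and its regular representation\<close>

lemma (in fd_space) subspace_carrier: "subspace B"
  using finite_dimensional subspace_span by blast

lemma (in bilinear_algebra)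
  assumes "a \<in> B" "b \<in> B" "c \<in> B"
  shows mult_diff_left: "mult (a - c) b = mult a b - mult c b"
    and mult_diff_right: "mult a (b - c) = mult a b - mult a c"
proof -
  have neg: "- x \<in> B" if "x \<in> B" for x
    using subspace_carrier that by (rule subspace_neg)
  have l: "mult (- x) b = - mult x b" if "x \<in> B" for x
    using mult_scale_left[OF that assms(2), of "- 1"] by simp
  have r: "mult a (- x) = - mult a x" if "x \<in> B" for x
    using mult_scale_right[OF assms(1) that, of "- 1"] by simp
  show "mult (a - c) b = mult a b - mult c b"
    using mult_add_left[OF assms(1) neg[OF assms(3)] assms(2)] l[OF assms(3)] by simp
  show "mult a (b - c) = mult a b - mult a c"
    using mult_add_right[OF assms(1,2) neg[OF assms(3)]] r[OF assms(3)] by simp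
qed

lemma bilinear_algebra_assoc:
  assumes "bilinear_algebra scale B lhd" "bilinear_algebra scale B rhd"
  shows "bilinear_algebra scale B (assoc_circ lhd rhd)"
proof -
  interpret l: bilinear_algebra scale B lhd by fact
  interpret r: bilinear_algebra scale B rhd by fact
  show ?thesis
    by unfold_locales
      (simp_all add: assoc_circ_def l.mult_closed r.mult_closed l.subspace_add[OF l.subspace_carrier]
        l.mult_add_left r.mult_add_left l.mult_add_right r.mult_add_right l.mult_scale_left
        r.mult_scale_left l.mult_scale_right r.mult_scale_right l.scale_right_distrib)
qed

lemma (in left_symmetric_algebra) lie_algebra_commutator:
  "lie_algebra scale B (assoc_bracket mult)"
proof
  fix a b c assume *: "a \<in> B" "b \<in> B" "c \<in> B"
  have "mult (mult a b) c = mult (mult b a) c - mult b (mult a c) + mult a (mult b c)"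
    and "mult (mult b c) a = mult (mult c b) a - mult c (mult b a) + mult b (mult c a)"
    and "mult (mult c a) b = mult (mult a c) b - mult a (mult c b) + mult c (mult a b)"
    using left_symmetric[OF *(1,2,3)] left_symmetric[OF *(2,3,1)] left_symmetric[OF *(3,1,2)]
    by (simp_all add: algebra_simps)
  then show "assoc_bracket mult a (assoc_bracket mult b c) + assoc_bracket mult b (assoc_bracket mult c a)
      + assoc_bracket mult c (assoc_bracket mult a b) = 0"
    using *
    by (simp add: assoc_bracket_def mult_diff_left mult_diff_right mult_closed)
qed (auto simp: assoc_bracket_def mult_closed mult_add_left mult_add_right mult_scale_left
      mult_scale_right scale_right_diff_distrib subspace_diff[OF subspace_carrier])

text \<open>
  Left-symmetry and the compatibility condition are signed sums of pre-Gel'fand-Dorfman axioms, with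
  arguments chosen so that the mixed terms cancel: left-symmetry needs the first pre-Novikov
  axiom once and the second one in both orders of \<open>a, b\<close>; the compatibility condition needs the
  second mixed axiom for \<open>(a, b, c)\<close> and \<open>(a, c, b)\<close> and the first one for \<open>(b, c, a)\<close>.
\<close>

theorem (in pre_GD_algebra) GD_algebra_associated:
  "GD_algebra scale B (assoc_circ lhd rhd) (assoc_bracket dia)"
proof -
  interpret circ: bilinear_algebra scale B "assoc_circ lhd rhd"
    by (rule bilinear_algebra_assoc) unfold_locales
  interpret lie: lie_algebra scale B "assoc_bracket dia"
    by (rule dia.lie_algebra_commutator)
  note closed = lhd.mult_closed rhd.mult_closed dia.mult_closed
  note lin = lhd.mult_add_left rhd.mult_add_left dia.mult_add_left
    lhd.mult_add_right rhd.mult_add_right dia.mult_add_right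
    lhd.mult_diff_left rhd.mult_diff_left lhd.mult_diff_right rhd.mult_diff_right
  show ?thesis
  proof
    fix a b c assume *: "a \<in> B" "b \<in> B" "c \<in> B"
    let ?o = "assoc_circ lhd rhd" and ?br = "assoc_bracket dia"
    have "a \<rhd> (b \<rhd> c) = (a \<rhd> b) \<rhd> c + (a \<lhd> b) \<rhd> c + b \<rhd> (a \<rhd> c) - (b \<rhd> a) \<rhd> c - (b \<lhd> a) \<rhd> c"
      using pre_novikov1[OF *] by (simp add: lin closed *)
    moreover have "a \<rhd> (b \<lhd> c) = (a \<rhd> b) \<lhd> c + b \<lhd> (a \<lhd> c) + b \<lhd> (a \<rhd> c) - (b \<lhd> a) \<lhd> c"
      using pre_novikov2[OF *] by (simp add: lin closed *)
    moreover have "b \<rhd> (a \<lhd> c) = (b \<rhd> a) \<lhd> c + a \<lhd> (b \<lhd> c) + a \<lhd> (b \<rhd> c) - (a \<lhd> b) \<lhd> c"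
      using pre_novikov2[OF *(2,1,3)] by (simp add: lin closed *)
    ultimately show "?o (?o a b) c - ?o a (?o b c) = ?o (?o b a) c - ?o b (?o a c)"
      by (simp add: assoc_circ_def lin closed *)
    show "?o (?o a b) c = ?o (?o a c) b"
      using pre_novikov3[OF *] pre_novikov3[OF *(1,3,2)] pre_novikov4[OF *]
      by (simp add: assoc_circ_def lin closed * add_ac)
    have "dia (a \<lhd> b) c = - dia (a \<rhd> b) c - (dia a b) \<rhd> c + (dia b a) \<rhd> c
        + a \<rhd> (dia b c) - dia b (a \<rhd> c) + (dia a c) \<lhd> b"
      using pre_GD2[OF *] by (simp add: lin closed *) (simp add: algebra_simps)
    moreover have "dia (a \<lhd> c) b = - dia (a \<rhd> c) b - (dia a c) \<rhd> b + (dia c a) \<rhd> b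
        + a \<rhd> (dia c b) - dia c (a \<rhd> b) + (dia a b) \<lhd> c"
      using pre_GD2[OF *(1,3,2)] by (simp add: lin closed *) (simp add: algebra_simps)
    moreover have "a \<lhd> dia b c = a \<lhd> dia c b + dia b (a \<lhd> c) + (dia c a) \<lhd> b - dia c (a \<lhd> b)
        - (dia b a) \<lhd> c"
      using pre_GD1[OF *(2,3,1)] by (simp add: lin closed *) (simp add: algebra_simps)
    ultimately show "?br (?o a b) c - ?br (?o a c) b + ?o (?br a b) c - ?o (?br a c) b - ?o a (?br b c) = 0"
      by (simp add: assoc_circ_def assoc_bracket_def lin closed *)
  qed
qed

lemma (in bilinear_algebra)
  assumes "B = UNIV"
  shows linear_action_left_mult: "linear_action scale scale (left_mult mult)"
    and linear_action_right_mult: "linear_action scale scale (right_mult mult)"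
  unfolding linear_action_def left_mult_def right_mult_def
  by (auto simp: Vector_Spaces.linear_iff vector_space_axioms assms mult_add_left mult_add_right mult_scale_left mult_scale_right)

text \<open>
  The axioms of a representation, read for left and right multiplications, are the
  pre-Gel'fand-Dorfman axioms one by one, up to renaming of the arguments and order of the terms.
\<close>

theorem GD_representation_pre_GD:
  assumes "pre_GD_algebra sA UNIV lhd rhd dia"
  shows "GD_representation sA (assoc_circ lhd rhd) (assoc_bracket dia)
    sA (left_mult rhd) (right_mult lhd) (left_mult dia)"
proof -
  interpret pre_GD_algebra sA UNIV lhd rhd dia by fact
  interpret GD_algebra sA UNIV "assoc_circ lhd rhd" "assoc_bracket dia"
    by (rule GD_algebra_associated)
  show ?thesis
  proof
    fix a b v
    show "left_mult dia (assoc_bracket dia a b) v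
        = left_mult dia a (left_mult dia b v) - left_mult dia b (left_mult dia a v)"
      using dia.left_symmetric[of a b v]
      by (simp add: left_mult_def assoc_bracket_def dia.mult_diff_left algebra_simps)
    show "left_mult rhd (assoc_circ lhd rhd a b - assoc_circ lhd rhd b a) v
        = left_mult rhd a (left_mult rhd b v) - left_mult rhd b (left_mult rhd a v)"
      using pre_novikov1[of a b v]
      by (simp add: left_mult_def assoc_circ_def rhd.mult_diff_left algebra_simps)
    show "left_mult rhd a (right_mult lhd b v) - right_mult lhd b (left_mult rhd a v)
        = right_mult lhd (assoc_circ lhd rhd a b) v - right_mult lhd b (right_mult lhd a v)"
      using pre_novikov2[of a v b] by (simp add: left_mult_def right_mult_def assoc_circ_def)
    show "left_mult rhd (assoc_circ lhd rhd a b) v = right_mult lhd b (left_mult rhd a v)"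
      using pre_novikov3[of a b v] by (simp add: left_mult_def right_mult_def assoc_circ_def)
    show "right_mult lhd a (right_mult lhd b v) = right_mult lhd b (right_mult lhd a v)"
      using pre_novikov4[of v a b] by (simp add: right_mult_def)
    show "left_mult dia a (left_mult rhd b v) + left_mult dia (assoc_circ lhd rhd b a) v
        + left_mult rhd (assoc_bracket dia b a) v - right_mult lhd a (left_mult dia b v)
        - left_mult rhd b (left_mult dia a v) = 0"
      using pre_GD2[of b a v]
      by (simp add: left_mult_def right_mult_def assoc_circ_def assoc_bracket_def)
        (simp add: algebra_simps)
    show "left_mult dia a (right_mult lhd b v) - left_mult dia b (right_mult lhd a v)
        - right_mult lhd b (left_mult dia a v) + right_mult lhd a (left_mult dia b v)
        - right_mult lhd (assoc_bracket dia a b) v = 0"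
      using pre_GD1[of a b v]
      by (simp add: left_mult_def right_mult_def assoc_bracket_def) (simp add: algebra_simps)
  qed (simp_all add: lhd.linear_action_right_mult rhd.linear_action_left_mult
      dia.linear_action_left_mult)
qed

section \<open>O-operators\<close>

text \<open>
  For \<open>T = id\<close> the two O-operator identities are the definitions of the associated operations.
\<close>

theorem O_operator_id:
  assumes "pre_GD_algebra sA UNIV lhd rhd dia"
  shows "O_operator sA (assoc_circ lhd rhd) (assoc_bracket dia)
    sA (left_mult rhd) (right_mult lhd) (left_mult dia) id"
proof -
  interpret GD_representation sA "assoc_circ lhd rhd" "assoc_bracket dia"
    sA "left_mult rhd" "right_mult lhd" "left_mult dia"
    using assms by (rule GD_representation_pre_GD)
  show ?thesis
    by unfold_locales
      (simp_all add: assoc_circ_def assoc_bracket_def left_mult_def right_mult_def add.commute)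
qed

lemma linear_action_linear:
  assumes "linear_action sA sV \<phi>"
  shows "Vector_Spaces.linear sV sV (\<phi> a)" "Vector_Spaces.linear sA sV (\<lambda>a. \<phi> a v)"
  using assms by (auto simp: linear_action_def)

lemma linear_action_simps:
  assumes "linear_action sA sV \<phi>"
  shows "\<phi> (a + b) v = \<phi> a v + \<phi> b v" "\<phi> (a - b) v = \<phi> a v - \<phi> b v" "\<phi> (- a) v = - \<phi> a v"
    "\<phi> (sA c a) v = sV c (\<phi> a v)" "\<phi> 0 v = 0"
    "\<phi> a (v + w) = \<phi> a v + \<phi> a w" "\<phi> a (v - w) = \<phi> a v - \<phi> a w" "\<phi> a (- v) = - \<phi> a v"
    "\<phi> a (sV c v) = sV c (\<phi> a v)" "\<phi> a 0 = 0"
proof -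
  interpret l: Vector_Spaces.linear sA sV "\<lambda>a. \<phi> a v" using assms by (rule linear_action_linear)
  interpret r: Vector_Spaces.linear sV sV "\<phi> a" using assms by (rule linear_action_linear)
  show "\<phi> (a + b) v = \<phi> a v + \<phi> b v" "\<phi> (a - b) v = \<phi> a v - \<phi> b v" "\<phi> (- a) v = - \<phi> a v"
    "\<phi> (sA c a) v = sV c (\<phi> a v)" "\<phi> 0 v = 0"
    by (fact l.add l.diff l.neg l.scale l.zero)+
  show "\<phi> a (v + w) = \<phi> a v + \<phi> a w" "\<phi> a (v - w) = \<phi> a v - \<phi> a w" "\<phi> a (- v) = - \<phi> a v"
    "\<phi> a (sV c v) = sV c (\<phi> a v)" "\<phi> a 0 = 0"
    by (fact r.add r.diff r.neg r.scale r.zero)+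
qed

text \<open>
  Read from right to left, the O-operator identities say that \<open>T\<close> carries the associated operations
  of the candidate structure on \<open>V\<close> to the operations of \<open>A\<close>. Hence a nested product such as
  \<open>l (T (l (T a) b + r (T b) a)) c\<close> is \<open>l\<close> of a product in \<open>A\<close>, and every required identity is an
  axiom of the representation evaluated at two values of \<open>T\<close>.
\<close>

theorem (in O_operator) pre_GD_algebra_O_operator:
  "pre_GD_algebra sV UNIV (\<lambda>u v. r (T v) u) (\<lambda>u v. l (T u) v) (\<lambda>u v. \<rho> (T u) v)"
proof -
  interpret T: Vector_Spaces.linear sV sA T by (fact linear_T)
  note act = linear_action_simps[OF linear_l] linear_action_simps[OF linear_r]
    linear_action_simps[OF linear_\<rho>]
  note Tsimps = T.add T.diff T.scale
  show ?thesis
  proof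
    fix a b c
    have circ: "T (l (T u) v) + T (r (T v) u) = T u \<circ>\<^sub>A T v" for u v
      by (simp add: O_circ T.add)
    have bracket: "T (\<rho> (T u) v) - T (\<rho> (T v) u) = [T u, T v]\<^sub>A" for u v
      by (simp add: O_bracket T.diff)
    show "\<rho> (T (\<rho> (T a) b)) c - \<rho> (T a) (\<rho> (T b) c) = \<rho> (T (\<rho> (T b) a)) c - \<rho> (T b) (\<rho> (T a) c)"
      using lie_rep[of "T a" "T b" c] by (simp add: bracket[symmetric] act algebra_simps)
    show "l (T a) (l (T b) c) = l (T (l (T a) b + r (T b) a)) c + l (T b) (l (T a) c)
        - l (T (l (T b) a + r (T a) b)) c"
      using rep1[of "T a" "T b" c] by (simp add: Tsimps circ act algebra_simps)
    show "l (T a) (r (T c) b) = r (T c) (l (T a) b) + r (T (r (T c) a + l (T a) c)) b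
        - r (T c) (r (T a) b)"
      using rep2[of "T a" "T c" b] circ[of a c] by (simp add: Tsimps add.commute algebra_simps)
    show "l (T (r (T b) a + l (T a) b)) c = r (T b) (l (T a) c)"
      using rep3[of "T a" "T b" c] circ[of a b] by (simp add: Tsimps add.commute)
    show "r (T c) (r (T b) a) = r (T b) (r (T c) a)"
      by (rule rep4)
    show "r (T (\<rho> (T a) b - \<rho> (T b) a)) c - \<rho> (T a) (r (T b) c) - r (T a) (\<rho> (T b) c)
        = - \<rho> (T b) (r (T a) c) - r (T b) (\<rho> (T a) c)"
      using rep6[of "T a" "T b" c] by (simp add: Tsimps bracket algebra_simps)
    show "l (T (\<rho> (T a) b - \<rho> (T b) a)) c + \<rho> (T (r (T b) a + l (T a) b)) c
        = l (T a) (\<rho> (T b) c) - \<rho> (T b) (l (T a) c) + r (T b) (\<rho> (T a) c)"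
      using rep5[of "T b" "T a" c] circ[of a b] by (simp add: Tsimps bracket add.commute algebra_simps)
  qed (simp_all add: act Tsimps)
qed

section \<open>Semi-direct products\<close>

lemma sum_scale_apply: "sum_scale sA sW c (a, u) = (sA c a, sW c u)"
  by (simp add: sum_scale_def)

lemma vector_space_sum_scale:
  assumes "vector_space sA" "vector_space sW"
  shows "vector_space (sum_scale sA sW)"
proof -
  interpret A: vector_space sA by fact
  interpret W: vector_space sW by fact
  show ?thesis
    by unfold_locales (auto simp: sum_scale_def algebra_simps A.scale_left_distrib
        A.scale_right_distrib W.scale_left_distrib W.scale_right_distrib)
qed

lemma vector_space_dual_scale: "vector_space dual_scale"
  by unfold_locales (auto simp: dual_scale_def algebra_simps)

lemma fd_space_sum_scale:
  assumes "fd_space sA A" "fd_space sW W"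
  shows "fd_space (sum_scale sA sW) (A \<times> W)"
proof -
  interpret A: fd_space sA A by fact
  interpret W: fd_space sW W by fact
  interpret P: vector_space "sum_scale sA sW"
    by (rule vector_space_sum_scale) unfold_locales
  obtain S T where S: "finite S" "A.span S = A" and T: "finite T" "W.span T = W"
    using A.finite_dimensional W.finite_dimensional by blast
  let ?U = "(\<lambda>a. (a, 0)) ` S \<union> Pair 0 ` T"
  have left: "(a, 0) \<in> P.span ?U" if "a \<in> A.span S" for a
    using that
  proof (induction rule: A.span_induct_alt)
    case base
    then show ?case using P.span_zero by (simp add: zero_prod_def)
  next
    case (step c x y)
    then have "sum_scale sA sW c (x, 0) + (y, 0) \<in> P.span ?U"
      by (intro P.span_add P.span_scale) (auto intro: P.span_base)
    then show ?case by (simp add: sum_scale_apply)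
  qed
  have right: "(0, w) \<in> P.span ?U" if "w \<in> W.span T" for w
    using that
  proof (induction rule: W.span_induct_alt)
    case base
    then show ?case using P.span_zero by (simp add: zero_prod_def)
  next
    case (step c x y)
    then have "sum_scale sA sW c (0, x) + (0, y) \<in> P.span ?U"
      by (intro P.span_add P.span_scale) (auto intro: P.span_base)
    then show ?case by (simp add: sum_scale_apply)
  qed
  have "P.span ?U \<subseteq> A \<times> W"
  proof (rule P.span_minimal)
    show "?U \<subseteq> A \<times> W"
      using S T A.span_superset[of S] W.span_superset[of T]
        A.subspace_0[OF A.subspace_carrier] W.subspace_0[OF W.subspace_carrier] by auto
    show "P.subspace (A \<times> W)"
      using A.subspace_carrier W.subspace_carrier
      by (auto simp: P.subspace_def A.subspace_def W.subspace_def sum_scale_def zero_prod_def)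
  qed
  moreover have "(a, w) \<in> P.span ?U" if "a \<in> A" "w \<in> W" for a w
    using P.span_add[OF left right, of a w] that S T by simp
  ultimately show ?thesis
    using S T by unfold_locales (auto intro!: exI[of _ ?U])
qed

text \<open>
  Linear maps from \<open>A\<close> to \<open>End W\<close> for a subspace \<open>W\<close> of an ambient space. The dual of a space is a
  set of functions, so the actions on it are well behaved only on that set.
\<close>

definition action_on ::
  "('k::field_char_0 \<Rightarrow> 'a::ab_group_add \<Rightarrow> 'a) \<Rightarrow> ('k \<Rightarrow> 'w::ab_group_add \<Rightarrow> 'w) \<Rightarrow> 'w set
    \<Rightarrow> ('a \<Rightarrow> 'w \<Rightarrow> 'w) \<Rightarrow> bool"
where
  "action_on sA sW W \<phi> \<longleftrightarrow> (\<forall>a. \<forall>v\<in>W. \<phi> a v \<in> W \<and>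
      (\<forall>b. \<phi> (a + b) v = \<phi> a v + \<phi> b v) \<and> (\<forall>c. \<phi> (sA c a) v = sW c (\<phi> a v)) \<and>
      (\<forall>w\<in>W. \<phi> a (v + w) = \<phi> a v + \<phi> a w) \<and> (\<forall>c. \<phi> a (sW c v) = sW c (\<phi> a v)))"

text \<open>
  The axioms of \<open>GD_representation\<close> relative to a carrier, as required for representations on a
  dual space.
\<close>

locale GD_representation_on =
  GD_algebra sA UNIV circ bracket + W: fd_space sW W
  for sA :: "'k::field_char_0 \<Rightarrow> 'a::ab_group_add \<Rightarrow> 'a"
    and circ (infixl \<open>\<circ>\<^sub>A\<close> 70) and bracket (\<open>[_,_]\<^sub>A\<close>)
    and sW :: "'k \<Rightarrow> 'w::ab_group_add \<Rightarrow> 'w" and W +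
  fixes l r \<rho> :: "'a \<Rightarrow> 'w \<Rightarrow> 'w"
  assumes action_l: "action_on sA sW W l"
    and action_r: "action_on sA sW W r"
    and action_\<rho>: "action_on sA sW W \<rho>"
    and lie_rep: "v \<in> W \<Longrightarrow> \<rho> [a,b]\<^sub>A v = \<rho> a (\<rho> b v) - \<rho> b (\<rho> a v)"
    and rep1: "v \<in> W \<Longrightarrow> l (a \<circ>\<^sub>A b - b \<circ>\<^sub>A a) v = l a (l b v) - l b (l a v)"
    and rep2: "v \<in> W \<Longrightarrow> l a (r b v) - r b (l a v) = r (a \<circ>\<^sub>A b) v - r b (r a v)"
    and rep3: "v \<in> W \<Longrightarrow> l (a \<circ>\<^sub>A b) v = r b (l a v)"
    and rep4: "v \<in> W \<Longrightarrow> r a (r b v) = r b (r a v)"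
    and rep5: "v \<in> W \<Longrightarrow>
      \<rho> a (l b v) + \<rho> (b \<circ>\<^sub>A a) v + l [b,a]\<^sub>A v - r a (\<rho> b v) - l b (\<rho> a v) = 0"
    and rep6: "v \<in> W \<Longrightarrow>
      \<rho> a (r b v) - \<rho> b (r a v) - r b (\<rho> a v) + r a (\<rho> b v) - r [a,b]\<^sub>A v = 0"

lemma (in lie_algebra) bracket_commute:
  assumes "a \<in> B" "b \<in> B"
  shows "bracket b a = - bracket a b"
proof -
  have ab: "a + b \<in> B"
    using assms by (rule subspace_add[OF subspace_carrier])
  then have "bracket (a + b) (a + b) = bracket a a + bracket b a + (bracket a b + bracket b b)"
    using assms by (simp add: mult_add_left mult_add_right)
  then show ?thesis
    using assms ab by (simp add: alternating eq_neg_iff_add_eq_0)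
qed

context GD_representation_on
begin

lemma action_closed [simp]: "v \<in> W \<Longrightarrow> l a v \<in> W" "v \<in> W \<Longrightarrow> r a v \<in> W" "v \<in> W \<Longrightarrow> \<rho> a v \<in> W"
  using action_l action_r action_\<rho> by (auto simp: action_on_def)

lemma carrier_closed [simp]:
  "v \<in> W \<Longrightarrow> w \<in> W \<Longrightarrow> v + w \<in> W" "v \<in> W \<Longrightarrow> w \<in> W \<Longrightarrow> v - w \<in> W" "v \<in> W \<Longrightarrow> - v \<in> W"
  "v \<in> W \<Longrightarrow> sW c v \<in> W"
  using W.subspace_carrier
  by (simp_all add: W.subspace_add W.subspace_diff W.subspace_neg W.subspace_scale)

lemma action_add:
  assumes "v \<in> W" "w \<in> W"
  shows "l (a + b) v = l a v + l b v" "r (a + b) v = r a v + r b v" "\<rho> (a + b) v = \<rho> a v + \<rho> b v"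
    "l a (v + w) = l a v + l a w" "r a (v + w) = r a v + r a w" "\<rho> a (v + w) = \<rho> a v + \<rho> a w"
  using assms action_l action_r action_\<rho> by (auto simp: action_on_def)

lemma action_scale:
  assumes "v \<in> W"
  shows "l (sA c a) v = sW c (l a v)" "r (sA c a) v = sW c (r a v)" "\<rho> (sA c a) v = sW c (\<rho> a v)"
    "l a (sW c v) = sW c (l a v)" "r a (sW c v) = sW c (r a v)" "\<rho> a (sW c v) = sW c (\<rho> a v)"
  using assms action_l action_r action_\<rho> by (auto simp: action_on_def)

lemma action_minus:
  assumes "v \<in> W"
  shows "l (- a) v = - l a v" "r (- a) v = - r a v" "\<rho> (- a) v = - \<rho> a v"
    "l a (- v) = - l a v" "r a (- v) = - r a v" "\<rho> a (- v) = - \<rho> a v"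
  using action_scale[OF assms, where c = "- 1"] by simp_all

lemma action_diff:
  assumes "v \<in> W" "w \<in> W"
  shows "l (a - b) v = l a v - l b v" "r (a - b) v = r a v - r b v" "\<rho> (a - b) v = \<rho> a v - \<rho> b v"
    "l a (v - w) = l a v - l a w" "r a (v - w) = r a v - r a w" "\<rho> a (v - w) = \<rho> a v - \<rho> a w"
  using action_add(1-3)[of v v, where a = a and b = "- b"] action_add(4-6)[of v "- w"] assms
  by (simp_all add: action_minus)

lemmas action_simps = action_add action_scale action_minus action_diff

lemma bilinear_algebra_semidirect_circ:
  "bilinear_algebra (sum_scale sA sW) (UNIV \<times> W) (semidirect_circ circ l r)"
proof -
  interpret P: fd_space "sum_scale sA sW" "UNIV \<times> W"
    by (rule fd_space_sum_scale) unfold_locales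
  show ?thesis
    by unfold_locales
      (auto simp: semidirect_circ_def sum_scale_def action_simps novikov.mult_add_left
        novikov.mult_add_right novikov.mult_scale_left novikov.mult_scale_right
        W.scale_right_distrib)
qed

lemma bilinear_algebra_semidirect_bracket:
  "bilinear_algebra (sum_scale sA sW) (UNIV \<times> W) (semidirect_bracket bracket \<rho>)"
proof -
  interpret P: fd_space "sum_scale sA sW" "UNIV \<times> W"
    by (rule fd_space_sum_scale) unfold_locales
  show ?thesis
    by unfold_locales
      (auto simp: semidirect_bracket_def sum_scale_def action_simps lie.mult_add_left
        lie.mult_add_right lie.mult_scale_left lie.mult_scale_right W.scale_right_diff_distrib)
qed

text \<open>
  In each identity with three arguments, the \<open>A\<close>-component is the same identity in \<open>A\<close>. Every term
  of the \<open>W\<close>-component contains exactly one of the three \<open>W\<close>-entries, and the terms that contain a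
  given entry form one of the axioms of a representation.
\<close>

theorem GD_algebra_semidirect:
  "GD_algebra (sum_scale sA sW) (UNIV \<times> W) (semidirect_circ circ l r)
    (semidirect_bracket bracket \<rho>)"
proof -
  interpret circ: bilinear_algebra "sum_scale sA sW" "UNIV \<times> W" "semidirect_circ circ l r"
    by (rule bilinear_algebra_semidirect_circ)
  interpret bracket: bilinear_algebra "sum_scale sA sW" "UNIV \<times> W" "semidirect_bracket bracket \<rho>"
    by (rule bilinear_algebra_semidirect_bracket)
  let ?o = "semidirect_circ circ l r" and ?br = "semidirect_bracket bracket \<rho>"
  have rep1': "l (a \<circ>\<^sub>A b) w = l (b \<circ>\<^sub>A a) w + l a (l b w) - l b (l a w)" if "w \<in> W" for a b w
    using rep1[OF that, of a b] that by (simp add: action_simps algebra_simps)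
  have rep2': "r (a \<circ>\<^sub>A b) w = l a (r b w) - r b (l a w) + r b (r a w)" if "w \<in> W" for a b w
    using rep2[OF that, of a b] that by (simp add: algebra_simps)
  have rep5': "\<rho> (b \<circ>\<^sub>A a) w = - \<rho> a (l b w) - l [b,a]\<^sub>A w + r a (\<rho> b w) + l b (\<rho> a w)"
    if "w \<in> W" for a b w
    using rep5[OF that, of a b] by (simp add: eq_neg_iff_add_eq_0 algebra_simps)
  have rep6': "r [a,b]\<^sub>A w = \<rho> a (r b w) - \<rho> b (r a w) - r b (\<rho> a w) + r a (\<rho> b w)"
    if "w \<in> W" for a b w
    using rep6[OF that, of a b] by (simp add: algebra_simps)
  show ?thesis
  proof
    fix x y z :: "'a \<times> 'w"
    assume "x \<in> UNIV \<times> W" "y \<in> UNIV \<times> W" "z \<in> UNIV \<times> W"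
    then obtain a u b v c w where [simp]: "x = (a, u)" "y = (b, v)" "z = (c, w)"
      and *: "u \<in> W" "v \<in> W" "w \<in> W"
      by auto
    show "?o (?o x y) z - ?o x (?o y z) = ?o (?o y x) z - ?o y (?o x z)"
      using * novikov.left_symmetric[of a b c] rep1'[of w a b]
      by (simp add: semidirect_circ_def action_simps rep2')
    show "?o (?o x y) z = ?o (?o x z) y"
      using * novikov.right_commutative[of a b c] rep3[of w a b] rep3[of v a c] rep4[of u b c]
      by (simp add: semidirect_circ_def action_simps)
    show "?br x x = 0"
      by (simp add: semidirect_bracket_def lie.alternating zero_prod_def)
    show "?br x (?br y z) + ?br y (?br z x) + ?br z (?br x y) = 0"
      using * lie.jacobi[of a b c]
      by (simp add: semidirect_bracket_def action_simps lie_rep zero_prod_def)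
    show "?br (?o x y) z - ?br (?o x z) y + ?o (?br x y) z - ?o (?br x z) y - ?o x (?br y z) = 0"
      using * GD_compatible[of a b c] lie.bracket_commute[of b c]
      by (simp add: semidirect_circ_def semidirect_bracket_def action_simps rep5' rep6' zero_prod_def)
  qed
qed

end

section \<open>The dual representation\<close>

lemma dual_space_iff:
  fixes sV :: "'k::field_char_0 \<Rightarrow> 'v::ab_group_add \<Rightarrow> 'v"
  assumes "vector_space sV"
  shows "f \<in> dual_space sV \<longleftrightarrow> (\<forall>u v. f (u + v) = f u + f v) \<and> (\<forall>c u. f (sV c u) = c * f u)"
proof -
  have "vector_space ((*) :: 'k \<Rightarrow> 'k \<Rightarrow> 'k)"
    by unfold_locales (auto simp: algebra_simps)
  with assms show ?thesis
    by (auto simp: dual_space_def Vector_Spaces.linear_iff)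
qed

lemma dual_space_simps:
  assumes "f \<in> dual_space sV"
  shows "f (u + v) = f u + f v" "f (u - v) = f u - f v" "f (- u) = - f u" "f (sV c u) = c * f u"
    "f 0 = 0"
proof -
  interpret Vector_Spaces.linear sV "(*)" f
    using assms by (simp add: dual_space_def)
  show "f (u + v) = f u + f v" "f (u - v) = f u - f v" "f (- u) = - f u" "f (sV c u) = c * f u"
    "f 0 = 0"
    by (fact add diff neg scale zero)+
qed

lemma action_on_dual_action:
  assumes "linear_action sA sV \<phi>" "vector_space sV"
  shows "action_on sA dual_scale (dual_space sV) (dual_action \<phi>)"
  by (auto simp: action_on_def dual_action_def dual_space_iff[OF assms(2)] dual_scale_def
      linear_action_simps[OF assms(1)] algebra_simps)

lemma action_on_add:
  assumes "fd_space sW W" "action_on sA sW W \<phi>" "action_on sA sW W \<psi>"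
  shows "action_on sA sW W (\<phi> + \<psi>)"
proof -
  interpret fd_space sW W by fact
  show ?thesis
    using assms(2,3) subspace_add[OF subspace_carrier]
    by (auto simp: action_on_def scale_right_distrib algebra_simps)
qed

lemma action_on_minus:
  assumes "fd_space sW W" "action_on sA sW W \<phi>"
  shows "action_on sA sW W (- \<phi>)"
proof -
  interpret fd_space sW W by fact
  show ?thesis
    using assms(2) subspace_neg[OF subspace_carrier] by (auto simp: action_on_def)
qed

text \<open>
  The value at \<open>u\<close> of an axiom for the dual actions on \<open>f\<close> is \<open>f\<close> applied to an identity in \<open>V\<close>, in
  which operators occur in the reversed order. The summand \<open>r\<close> in the dual left action \<open>l + r\<close>
  compensates the reversal: for \<open>rep3\<close>, say, \<open>l a (r b u)\<close> takes the place of \<open>r b (l a u)\<close>, and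
  the difference of the two is supplied by \<open>r (a \<circ> b) u\<close> through \<open>rep2\<close>.
\<close>

theorem (in GD_representation) dual_representation:
  assumes "fd_space dual_scale (dual_space sV)"
  shows "GD_representation_on sA circ bracket dual_scale (dual_space sV)
    (dual_action l + dual_action r) (- dual_action r) (dual_action \<rho>)"
proof -
  interpret D: fd_space dual_scale "dual_space sV" by fact
  note act = linear_action_simps[OF linear_l] linear_action_simps[OF linear_r]
    linear_action_simps[OF linear_\<rho>]
  note dual = action_on_dual_action[OF _ V.vector_space_axioms]
  have rep1': "l (a \<circ>\<^sub>A b) u = l (b \<circ>\<^sub>A a) u + l a (l b u) - l b (l a u)" for a b u
    using rep1[of a b u] by (simp add: act algebra_simps)
  have rep2': "r (a \<circ>\<^sub>A b) u = l a (r b u) - r b (l a u) + r b (r a u)" for a b u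
    using rep2[of a b u] by (simp add: algebra_simps)
  have rep5': "\<rho> (b \<circ>\<^sub>A a) u = - \<rho> a (l b u) - l [b,a]\<^sub>A u + r a (\<rho> b u) + l b (\<rho> a u)" for a b u
    using rep5[of a b u] by (simp add: eq_neg_iff_add_eq_0 algebra_simps)
  have rep6': "r [a,b]\<^sub>A u = \<rho> a (r b u) - \<rho> b (r a u) - r b (\<rho> a u) + r a (\<rho> b u)" for a b u
    using rep6[of a b u] by (simp add: algebra_simps)
  show ?thesis
  proof
    fix a b and f :: "'v \<Rightarrow> 'k" assume f: "f \<in> dual_space sV"
    note simps = dual_action_def dual_space_simps[OF f] act
    show "dual_action \<rho> [a,b]\<^sub>A f
        = dual_action \<rho> a (dual_action \<rho> b f) - dual_action \<rho> b (dual_action \<rho> a f)"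
      by (rule ext) (simp add: simps lie_rep)
    show "(dual_action l + dual_action r) (a \<circ>\<^sub>A b - b \<circ>\<^sub>A a) f
        = (dual_action l + dual_action r) a ((dual_action l + dual_action r) b f)
        - (dual_action l + dual_action r) b ((dual_action l + dual_action r) a f)"
      by (rule ext) (use rep4 in \<open>simp add: simps rep1'[of a b] rep2'\<close>)
    show "(dual_action l + dual_action r) a ((- dual_action r) b f)
        - (- dual_action r) b ((dual_action l + dual_action r) a f)
        = (- dual_action r) (a \<circ>\<^sub>A b) f - (- dual_action r) b ((- dual_action r) a f)"
      by (rule ext) (simp add: simps rep2' rep4[of b a])
    show "(dual_action l + dual_action r) (a \<circ>\<^sub>A b) f
        = (- dual_action r) b ((dual_action l + dual_action r) a f)"
      by (rule ext) (simp add: simps rep3 rep2' rep4[of b a])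
    show "(- dual_action r) a ((- dual_action r) b f) = (- dual_action r) b ((- dual_action r) a f)"
      by (rule ext) (simp add: simps rep4[of b a])
    show "dual_action \<rho> a ((dual_action l + dual_action r) b f) + dual_action \<rho> (b \<circ>\<^sub>A a) f
        + (dual_action l + dual_action r) [b,a]\<^sub>A f - (- dual_action r) a (dual_action \<rho> b f)
        - (dual_action l + dual_action r) b (dual_action \<rho> a f) = 0"
      by (rule ext) (simp add: simps rep5' rep6')
    show "dual_action \<rho> a ((- dual_action r) b f) - dual_action \<rho> b ((- dual_action r) a f)
        - (- dual_action r) b (dual_action \<rho> a f) + (- dual_action r) a (dual_action \<rho> b f)
        - (- dual_action r) [a,b]\<^sub>A f = 0"
      by (rule ext) (simp add: simps rep6')
  qed (auto intro!: action_on_add action_on_minus dual linear_l linear_r linear_\<rho> assms)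
qed

section \<open>Dual bases\<close>

locale dual_bases = vector_space sA
  for sA :: "'k::field_char_0 \<Rightarrow> 'a::ab_group_add \<Rightarrow> 'a" +
  fixes I :: "'i set" and e :: "'i \<Rightarrow> 'a" and e' :: "'i \<Rightarrow> 'a \<Rightarrow> 'k"
  assumes finite_I: "finite I"
    and span_basis: "span (e ` I) = UNIV"
    and dual_basis: "\<alpha> \<in> I \<Longrightarrow> e' \<alpha> \<in> dual_space sA"
    and duality: "\<lbrakk>\<alpha> \<in> I; \<beta> \<in> I\<rbrakk> \<Longrightarrow> e' \<alpha> (e \<beta>) = (if \<alpha> = \<beta> then 1 else 0)"
begin

lemma expand_vector: "v = (\<Sum>\<alpha>\<in>I. sA (e' \<alpha> v) (e \<alpha>))"
proof -
  have "v \<in> span (e ` I)"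
    by (simp add: span_basis)
  then show ?thesis
  proof (induction rule: span_induct_alt)
    case base
    show ?case by (simp add: dual_space_simps[OF dual_basis])
  next
    case (step c x v)
    then obtain \<beta> where \<beta>: "\<beta> \<in> I" "x = e \<beta>" by auto
    have "(\<Sum>\<alpha>\<in>I. sA (e' \<alpha> (sA c x + v)) (e \<alpha>))
        = (\<Sum>\<alpha>\<in>I. (if \<alpha> = \<beta> then sA c (e \<alpha>) else 0) + sA (e' \<alpha> v) (e \<alpha>))"
      using \<beta> by (intro sum.cong) (auto simp: dual_space_simps[OF dual_basis] duality scale_left_distrib)
    also have "\<dots> = sA c x + v"
      using \<beta> finite_I step.IH by (simp add: sum.distrib)
    finally show ?case by simp
  qed
qed

lemma expand_functional:
  assumes "f \<in> dual_space sA"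
  shows "f = (\<Sum>\<alpha>\<in>I. dual_scale (f (e \<alpha>)) (e' \<alpha>))"
proof
  fix v
  have sum: "f (sum g I) = (\<Sum>\<alpha>\<in>I. f (g \<alpha>))" for g
    using finite_I by (induction I rule: finite_induct) (simp_all add: dual_space_simps[OF assms])
  have "f v = (\<Sum>\<alpha>\<in>I. f (sA (e' \<alpha> v) (e \<alpha>)))"
    using expand_vector[of v] sum by metis
  also have "\<dots> = (\<Sum>\<alpha>\<in>I. dual_scale (f (e \<alpha>)) (e' \<alpha>)) v"
    using finite_I
    by (induction I rule: finite_induct)
      (simp_all add: dual_scale_def dual_space_simps[OF assms] mult.commute)
  finally show "f v = (\<Sum>\<alpha>\<in>I. dual_scale (f (e \<alpha>)) (e' \<alpha>)) v" .
qed

lemma fd_space_dual: "fd_space dual_scale (dual_space sA)"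
proof -
  interpret D: vector_space dual_scale
    by (rule vector_space_dual_scale)
  have "f \<in> D.span (e' ` I)" if "f \<in> dual_space sA" for f
    by (subst expand_functional[OF that])
      (intro D.span_sum D.span_scale D.span_base imageI)
  moreover have "D.span (e' ` I) \<subseteq> dual_space sA"
  proof (rule D.span_minimal)
    show "e' ` I \<subseteq> dual_space sA"
      using dual_basis by blast
    show "D.subspace (dual_space sA)"
      by (auto simp: D.subspace_def dual_space_iff[OF vector_space_axioms] dual_scale_def
          algebra_simps)
  qed
  ultimately have "D.span (e' ` I) = dual_space sA"
    by blast
  then show ?thesis
    using finite_I by unfold_locales blast
qed

end

text \<open>
  Linearity of scalar-valued functions on a subspace; outside \<open>B\<close> the values are arbitrary.
\<close>

definition linear_form_on :: "('k::field \<Rightarrow> 'b::ab_group_add \<Rightarrow> 'b) \<Rightarrow> 'b set \<Rightarrow> ('b \<Rightarrow> 'k) \<Rightarrow> bool" where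
  "linear_form_on scale B h \<longleftrightarrow>
    (\<forall>x\<in>B. \<forall>y\<in>B. h (x + y) = h x + h y) \<and> (\<forall>c. \<forall>x\<in>B. h (scale c x) = c * h x)"

lemma (in vector_space) linear_form_on_simps:
  assumes "linear_form_on scale B h" "subspace B"
  shows "x \<in> B \<Longrightarrow> y \<in> B \<Longrightarrow> h (x + y) = h x + h y" "x \<in> B \<Longrightarrow> h (scale c x) = c * h x"
    "x \<in> B \<Longrightarrow> h (- x) = - h x" "x \<in> B \<Longrightarrow> y \<in> B \<Longrightarrow> h (x - y) = h x - h y" "h 0 = 0"
proof -
  show add: "h (x + y) = h x + h y" if "x \<in> B" "y \<in> B" for x y
    using assms that by (simp add: linear_form_on_def)
  show scale: "h (scale c x) = c * h x" if "x \<in> B" for c x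
    using assms that by (simp add: linear_form_on_def)
  show neg: "h (- x) = - h x" if "x \<in> B" for x
    using scale[OF that, of "- 1"] by simp
  show "h (x - y) = h x - h y" if "x \<in> B" "y \<in> B"
    using add[of x "- y"] neg[of y] that subspace_neg[OF assms(2), of y] by simp
  show "h 0 = 0"
    using scale[of 0 0] subspace_0[OF assms(2)] by simp
qed

lemma (in vector_space) linear_form_on_sum:
  assumes "linear_form_on scale B h" "subspace B" "\<And>i. i \<in> I \<Longrightarrow> x i \<in> B"
  shows "h (\<Sum>i\<in>I. scale (c i) (x i)) = (\<Sum>i\<in>I. c i * h (x i))"
  using assms(3)
  by (induction I rule: infinite_finite_induct)
    (simp_all add: linear_form_on_simps[OF assms(1,2)] subspace_sum[OF assms(2)]
      subspace_scale[OF assms(2)])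

text \<open>
  The canonical element \<open>\<Sum>\<alpha>. e\<^sub>\<alpha> \<otimes> e'\<^sub>\<alpha>\<close> represents the identity of \<open>A\<close>, so applying an operator to
  the first factor or its transpose to the second one gives the same element, namely the operator
  itself. In coordinates, both sides are minus the sum of the matrix
  entries \<open>e'\<^sub>\<alpha> (\<phi> b e\<^sub>\<beta>)\<close> times \<open>G e\<^sub>\<alpha> e'\<^sub>\<beta>\<close>; the sign is the one in the dual action.
\<close>

lemma (in dual_bases) trace_shift:
  assumes left: "\<And>f. f \<in> dual_space sA \<Longrightarrow> linear_form_on sA UNIV (\<lambda>a. G a f)"
    and right: "\<And>a. linear_form_on dual_scale (dual_space sA) (G a)"
    and act: "linear_action sB sA \<phi>"
  shows "(\<Sum>\<alpha>\<in>I. G (e \<alpha>) (dual_action \<phi> b (e' \<alpha>))) = - (\<Sum>\<alpha>\<in>I. G (\<phi> b (e \<alpha>)) (e' \<alpha>))"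
proof -
  interpret D: fd_space dual_scale "dual_space sA"
    by (rule fd_space_dual)
  have rsum: "G a (\<Sum>\<beta>\<in>I. dual_scale (c \<beta>) (e' \<beta>)) = (\<Sum>\<beta>\<in>I. c \<beta> * G a (e' \<beta>))" for a c
    by (rule D.linear_form_on_sum[OF right D.subspace_carrier dual_basis])
  note lsum = linear_form_on_sum[OF left[OF dual_basis] subspace_UNIV UNIV_I]
  have closed: "dual_action \<phi> b (e' \<alpha>) \<in> dual_space sA" if "\<alpha> \<in> I" for \<alpha>
    using action_on_dual_action[OF act vector_space_axioms] dual_basis[OF that]
    by (simp add: action_on_def)
  have "(\<Sum>\<alpha>\<in>I. G (e \<alpha>) (dual_action \<phi> b (e' \<alpha>)))
      = (\<Sum>\<alpha>\<in>I. \<Sum>\<beta>\<in>I. - (e' \<alpha> (\<phi> b (e \<beta>)) * G (e \<alpha>) (e' \<beta>)))"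
  proof (rule sum.cong[OF refl])
    fix \<alpha> assume \<alpha>: "\<alpha> \<in> I"
    show "G (e \<alpha>) (dual_action \<phi> b (e' \<alpha>)) = (\<Sum>\<beta>\<in>I. - (e' \<alpha> (\<phi> b (e \<beta>)) * G (e \<alpha>) (e' \<beta>)))"
      using rsum[where c = "\<lambda>\<beta>. dual_action \<phi> b (e' \<alpha>) (e \<beta>)" and a = "e \<alpha>"]
        expand_functional[OF closed[OF \<alpha>]]
      by (simp add: dual_action_def)
  qed
  also have "\<dots> = - (\<Sum>\<beta>\<in>I. \<Sum>\<alpha>\<in>I. e' \<alpha> (\<phi> b (e \<beta>)) * G (e \<alpha>) (e' \<beta>))"
    by (subst sum.swap) (simp add: sum_negf)
  also have "\<dots> = - (\<Sum>\<beta>\<in>I. G (\<phi> b (e \<beta>)) (e' \<beta>))"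
  proof (intro arg_cong[of _ _ uminus] sum.cong refl)
    fix \<beta> assume \<beta>: "\<beta> \<in> I"
    show "(\<Sum>\<alpha>\<in>I. e' \<alpha> (\<phi> b (e \<beta>)) * G (e \<alpha>) (e' \<beta>)) = G (\<phi> b (e \<beta>)) (e' \<beta>)"
      using lsum[OF \<beta>, of "\<lambda>\<alpha>. e' \<alpha> (\<phi> b (e \<beta>))" e I] expand_vector[of "\<phi> b (e \<beta>)"] by simp
  qed
  finally show ?thesis .
qed

section \<open>Testing tensors by linear functionals\<close>

text \<open>
  A vector outside a span is independent of a basis of that span, so some functional
  vanishes on the span but not at the vector. For tensors this replaces computations modulo the
  multilinearity relations by identities between scalars.
\<close>

lemma (in vector_space) in_span_if_annihilated:
  assumes "\<And>L. \<lbrakk>Vector_Spaces.linear scale (*) L; \<And>x. x \<in> S \<Longrightarrow> L x = 0\<rbrakk> \<Longrightarrow> L t = (0::'a)"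
  shows "t \<in> span S"
proof (rule ccontr)
  assume t: "t \<notin> span S"
  obtain C where C: "C \<subseteq> S" "independent C" "S \<subseteq> span C"
    using maximal_independent_subset[of S] by blast
  interpret K: vector_space "(*) :: 'a \<Rightarrow> 'a \<Rightarrow> 'a"
    by unfold_locales (auto simp: algebra_simps)
  interpret vector_space_pair scale "(*) :: 'a \<Rightarrow> 'a \<Rightarrow> 'a" ..
  have "t \<notin> span C"
    using t span_mono[OF C(1)] by blast
  then have indep: "independent (insert t C)" and tC: "t \<notin> C"
    using C(2) independent_insertI span_base by blast+
  obtain L where L: "Vector_Spaces.linear scale (*) L"
    and LC: "\<And>x. x \<in> insert t C \<Longrightarrow> L x = (if x = t then 1 else 0)"
    using linear_independent_extend[OF indep, of "\<lambda>x. if x = t then 1 else 0"] by blast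
  interpret L: Vector_Spaces.linear scale "(*)" L by (fact L)
  have "L x = 0" if "x \<in> span C" for x
    using that
  proof (induction rule: span_induct_alt)
    case (step c x y)
    then have "x \<noteq> t" "L x = 0" using LC tC by auto
    then show ?case using step by (simp add: L.add L.scale)
  qed (simp add: L.zero)
  then have "L t = 0"
    using assms[OF L] C(3) by blast
  then show False
    using LC[of t] by simp
qed

lemma lookup_tensor_scale [simp]:
  "Poly_Mapping.lookup (tensor_scale c t) p = c * Poly_Mapping.lookup t p"
  by (simp add: tensor_scale_def Poly_Mapping.map.rep_eq when_def)

lemma vector_space_tensor_scale: "vector_space tensor_scale"
  by unfold_locales (auto intro!: poly_mapping_eqI simp: lookup_add algebra_simps)

text \<open>
  The linear extension of a map given on the basis of a free vector space. As \<open>flip\<close> is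
  such an extension and \<open>double_sum\<close> an iterated one, both can be evaluated on a tensor written as
  any sum of pure tensors, without determining its support and coefficients.
\<close>

definition free_extend ::
  "('k::field \<Rightarrow> 'm::ab_group_add \<Rightarrow> 'm) \<Rightarrow> ('p \<Rightarrow> 'm) \<Rightarrow> ('p \<Rightarrow>\<^sub>0 'k) \<Rightarrow> 'm"
where
  "free_extend s g t = (\<Sum>p\<in>Poly_Mapping.keys t. s (Poly_Mapping.lookup t p) (g p))"

context vector_space
begin

lemma free_extend_superset:
  assumes "finite K" "Poly_Mapping.keys t \<subseteq> K"
  shows "free_extend scale g t = (\<Sum>p\<in>K. scale (Poly_Mapping.lookup t p) (g p))"
  unfolding free_extend_def using assms
  by (intro sum.mono_neutral_left) (auto simp: in_keys_iff)

lemma free_extend_add: "free_extend scale g (s + t) = free_extend scale g s + free_extend scale g t"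
proof -
  let ?K = "Poly_Mapping.keys s \<union> Poly_Mapping.keys t"
  have "Poly_Mapping.keys (s + t) \<subseteq> ?K" by (rule Poly_Mapping.keys_add)
  then show ?thesis
    by (simp add: free_extend_superset[of ?K] lookup_add scale_left_distrib sum.distrib)
qed

lemma free_extend_minus: "free_extend scale g (- t) = - free_extend scale g t"
  by (simp add: free_extend_def sum_negf)

lemma free_extend_diff: "free_extend scale g (s - t) = free_extend scale g s - free_extend scale g t"
  using free_extend_add[of g s "- t"] by (simp add: free_extend_minus)

lemma free_extend_sum: "free_extend scale g (\<Sum>i\<in>I. t i) = (\<Sum>i\<in>I. free_extend scale g (t i))"
proof -
  have "free_extend scale g 0 = 0" by (simp add: free_extend_def)
  then show ?thesis
    by (induction I rule: infinite_finite_induct) (simp_all add: free_extend_add)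
qed

lemma free_extend_single: "free_extend scale g (Poly_Mapping.single p 1) = g p"
  by (simp add: free_extend_def)

lemmas free_extend_simps =
  free_extend_add free_extend_minus free_extend_diff free_extend_sum free_extend_single

end

lemma double_sum_eq_free_extend:
  fixes t :: "'b list \<Rightarrow>\<^sub>0 'k::field_char_0"
  shows "double_sum F t = free_extend tensor_scale (\<lambda>p. free_extend tensor_scale
      (\<lambda>q. F (p ! 0) (p ! 1) (q ! 0) (q ! 1)) t) t"
proof -
  interpret M: vector_space "tensor_scale :: 'k \<Rightarrow> ('b list \<Rightarrow>\<^sub>0 'k) \<Rightarrow> _"
    by (rule vector_space_tensor_scale)
  show ?thesis
    by (simp add: double_sum_def free_extend_def M.scale_sum_right)
qed

lemma flip_eq_free_extend:
  "flip t = free_extend tensor_scale (\<lambda>p. pure_tensor [p ! 1, p ! 0]) t"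
  by (simp add: flip_def free_extend_def)

text \<open>
  The generators of \<open>tensor_relations\<close> at a fixed slot are the equations that express linearity in
  that slot.
\<close>

lemma linear_form_on_pure_tensor:
  assumes L: "Vector_Spaces.linear tensor_scale (*) L"
    and null: "\<And>x. x \<in> tensor_relations scale B n \<Longrightarrow> L x = 0"
    and "set us \<subseteq> B" "set vs \<subseteq> B" "length us + 1 + length vs = n"
  shows "linear_form_on scale B (\<lambda>x. L (pure_tensor (us @ x # vs)))"
proof -
  interpret L: Vector_Spaces.linear tensor_scale "(*)" L by (fact L)
  have "L (pure_tensor (us @ (x + y) # vs) - pure_tensor (us @ x # vs) - pure_tensor (us @ y # vs)) = 0"
    if "x \<in> B" "y \<in> B" for x y
    by (rule null) (use that assms(3-5) in \<open>unfold tensor_relations_def, blast\<close>)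
  moreover have "L (pure_tensor (us @ scale c x # vs) - tensor_scale c (pure_tensor (us @ x # vs))) = 0"
    if "x \<in> B" for c x
    by (rule null) (use that assms(3-5) in \<open>unfold tensor_relations_def, blast\<close>)
  ultimately show ?thesis
    by (simp add: linear_form_on_def L.diff L.scale diff_eq_eq add.commute)
qed

context dual_bases
begin

definition trilinear :: "('a \<Rightarrow> ('a \<Rightarrow> 'k) \<Rightarrow> ('a \<Rightarrow> 'k) \<Rightarrow> 'k) \<Rightarrow> bool" where
  "trilinear G \<longleftrightarrow>
    (\<forall>f\<in>dual_space sA. \<forall>g\<in>dual_space sA. linear_form_on sA UNIV (\<lambda>a. G a f g)) \<and>
    (\<forall>a. \<forall>g\<in>dual_space sA. linear_form_on dual_scale (dual_space sA) (\<lambda>f. G a f g)) \<and>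
    (\<forall>a. \<forall>f\<in>dual_space sA. linear_form_on dual_scale (dual_space sA) (G a f))"

text \<open>
  The four ways in which a dual action occurs in the equation, according to the slot of the
  covector acted upon and to the summation index of the acting basis vector. The results are
  written with the covectors in the order \<open>e' \<alpha>, e' \<beta>\<close>, so that they can be compared term by term.
\<close>

lemma double_trace_shift:
  assumes G: "trilinear G" and act: "linear_action sA sA \<phi>"
  shows "(\<Sum>\<alpha>\<in>I. \<Sum>\<beta>\<in>I. G (e \<alpha>) (dual_action \<phi> (e \<beta>) (e' \<alpha>)) (e' \<beta>))
      = - (\<Sum>\<alpha>\<in>I. \<Sum>\<beta>\<in>I. G (\<phi> (e \<beta>) (e \<alpha>)) (e' \<alpha>) (e' \<beta>))"
    and "(\<Sum>\<alpha>\<in>I. \<Sum>\<beta>\<in>I. G (e \<beta>) (dual_action \<phi> (e \<alpha>) (e' \<beta>)) (e' \<alpha>))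
      = - (\<Sum>\<alpha>\<in>I. \<Sum>\<beta>\<in>I. G (\<phi> (e \<beta>) (e \<alpha>)) (e' \<alpha>) (e' \<beta>))"
    and "(\<Sum>\<alpha>\<in>I. \<Sum>\<beta>\<in>I. G (e \<alpha>) (e' \<beta>) (dual_action \<phi> (e \<beta>) (e' \<alpha>)))
      = - (\<Sum>\<alpha>\<in>I. \<Sum>\<beta>\<in>I. G (\<phi> (e \<alpha>) (e \<beta>)) (e' \<alpha>) (e' \<beta>))"
    and "(\<Sum>\<alpha>\<in>I. \<Sum>\<beta>\<in>I. G (e \<beta>) (e' \<alpha>) (dual_action \<phi> (e \<alpha>) (e' \<beta>)))
      = - (\<Sum>\<alpha>\<in>I. \<Sum>\<beta>\<in>I. G (\<phi> (e \<alpha>) (e \<beta>)) (e' \<alpha>) (e' \<beta>))"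
proof -
  have mid: "(\<Sum>\<alpha>\<in>I. G (e \<alpha>) (dual_action \<phi> b (e' \<alpha>)) (e' \<beta>))
      = - (\<Sum>\<alpha>\<in>I. G (\<phi> b (e \<alpha>)) (e' \<alpha>) (e' \<beta>))" if "\<beta> \<in> I" for b \<beta>
    using G dual_basis[OF that]
    by (intro trace_shift[OF _ _ act, where G = "\<lambda>a f. G a f (e' \<beta>)"]) (auto simp: trilinear_def)
  have right: "(\<Sum>\<alpha>\<in>I. G (e \<alpha>) (e' \<beta>) (dual_action \<phi> b (e' \<alpha>)))
      = - (\<Sum>\<alpha>\<in>I. G (\<phi> b (e \<alpha>)) (e' \<beta>) (e' \<alpha>))" if "\<beta> \<in> I" for b \<beta>
    using G dual_basis[OF that]
    by (intro trace_shift[OF _ _ act, where G = "\<lambda>a. G a (e' \<beta>)"]) (auto simp: trilinear_def)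
  show "(\<Sum>\<alpha>\<in>I. \<Sum>\<beta>\<in>I. G (e \<alpha>) (dual_action \<phi> (e \<beta>) (e' \<alpha>)) (e' \<beta>))
      = - (\<Sum>\<alpha>\<in>I. \<Sum>\<beta>\<in>I. G (\<phi> (e \<beta>) (e \<alpha>)) (e' \<alpha>) (e' \<beta>))"
    by (subst (1 2) sum.swap) (simp add: mid sum_negf)
  show "(\<Sum>\<alpha>\<in>I. \<Sum>\<beta>\<in>I. G (e \<beta>) (dual_action \<phi> (e \<alpha>) (e' \<beta>)) (e' \<alpha>))
      = - (\<Sum>\<alpha>\<in>I. \<Sum>\<beta>\<in>I. G (\<phi> (e \<beta>) (e \<alpha>)) (e' \<alpha>) (e' \<beta>))"
    by (subst (2) sum.swap) (simp add: mid sum_negf)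
  show "(\<Sum>\<alpha>\<in>I. \<Sum>\<beta>\<in>I. G (e \<alpha>) (e' \<beta>) (dual_action \<phi> (e \<beta>) (e' \<alpha>)))
      = - (\<Sum>\<alpha>\<in>I. \<Sum>\<beta>\<in>I. G (\<phi> (e \<alpha>) (e \<beta>)) (e' \<alpha>) (e' \<beta>))"
    by (subst (1) sum.swap) (simp add: right sum_negf)
  show "(\<Sum>\<alpha>\<in>I. \<Sum>\<beta>\<in>I. G (e \<beta>) (e' \<alpha>) (dual_action \<phi> (e \<alpha>) (e' \<beta>)))
      = - (\<Sum>\<alpha>\<in>I. \<Sum>\<beta>\<in>I. G (\<phi> (e \<alpha>) (e \<beta>)) (e' \<alpha>) (e' \<beta>))"
    by (simp add: right sum_negf)
qed

definition canonical_skew_tensor :: "('a \<times> ('a \<Rightarrow> 'k)) list \<Rightarrow>\<^sub>0 'k" where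
  "canonical_skew_tensor =
    (\<Sum>\<alpha>\<in>I. pure_tensor [(e \<alpha>, 0), (0, e' \<alpha>)] - pure_tensor [(0, e' \<alpha>), (e \<alpha>, 0)])"

lemma canonical_skew_tensor_in_tensor_rep:
  "canonical_skew_tensor \<in> tensor_rep (UNIV \<times> dual_space sA) 2"
proof -
  have zero: "0 \<in> dual_space sA"
    by (simp add: dual_space_iff[OF vector_space_axioms])
  have "Poly_Mapping.keys canonical_skew_tensor
      \<subseteq> (\<Union>\<alpha>\<in>I. {[(e \<alpha>, 0), (0, e' \<alpha>)], [(0, e' \<alpha>), (e \<alpha>, 0)]})"
    unfolding canonical_skew_tensor_def pure_tensor_def
    by (rule order_trans[OF keys_sum] UN_mono order_trans[OF keys_diff] order_refl | simp)+
  then show ?thesis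
    using dual_basis zero by (fastforce simp: tensor_rep_def)
qed

lemma skew_symmetric_canonical_skew_tensor:
  "skew_symmetric (sum_scale sA dual_scale) (UNIV \<times> dual_space sA) canonical_skew_tensor"
proof -
  interpret M: vector_space "tensor_scale :: 'k \<Rightarrow> (('a \<times> ('a \<Rightarrow> 'k)) list \<Rightarrow>\<^sub>0 'k) \<Rightarrow> _"
    by (rule vector_space_tensor_scale)
  \<comment> \<open>The sum vanishes already in the free space, before passing to the quotient.\<close>
  have "canonical_skew_tensor + flip canonical_skew_tensor = 0"
    by (simp add: flip_eq_free_extend canonical_skew_tensor_def pure_tensor_def M.free_extend_simps
        sum.distrib[symmetric])
  then show ?thesis
    by (simp add: skew_symmetric_def canonical_skew_tensor_in_tensor_rep tensor_null_def M.span_zero)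
qed

lemma double_sum_canonical_skew_tensor:
  "double_sum F canonical_skew_tensor = (\<Sum>\<alpha>\<in>I. \<Sum>\<beta>\<in>I.
      F (e \<alpha>, 0) (0, e' \<alpha>) (e \<beta>, 0) (0, e' \<beta>) - F (e \<alpha>, 0) (0, e' \<alpha>) (0, e' \<beta>) (e \<beta>, 0)
      - F (0, e' \<alpha>) (e \<alpha>, 0) (e \<beta>, 0) (0, e' \<beta>) + F (0, e' \<alpha>) (e \<alpha>, 0) (0, e' \<beta>) (e \<beta>, 0))"
proof -
  interpret M: vector_space "tensor_scale :: 'k \<Rightarrow> (('a \<times> ('a \<Rightarrow> 'k)) list \<Rightarrow>\<^sub>0 'k) \<Rightarrow> _"
    by (rule vector_space_tensor_scale)
  show ?thesis
    by (simp add: double_sum_eq_free_extend canonical_skew_tensor_def pure_tensor_def M.free_extend_simps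
        sum_subtractf[symmetric] algebra_simps)
qed

end

text \<open>
  A linear functional on the third tensor power of \<open>A \<oplus> A\<^sup>*\<close>, given on representatives in the free
  space: the test object in the proof of the Yang-Baxter equation.
\<close>

locale trilinear_tensor_form = dual_bases sA I e e' +
  L: Vector_Spaces.linear tensor_scale "(*)" L
  for sA :: "'k::field_char_0 \<Rightarrow> 'a::ab_group_add \<Rightarrow> 'a" and I :: "'i set" and e e'
    and L :: "(('a \<times> ('a \<Rightarrow> 'k)) list \<Rightarrow>\<^sub>0 'k) \<Rightarrow> 'k" +
  assumes annihilates: "x \<in> tensor_relations (sum_scale sA dual_scale) (UNIV \<times> dual_space sA) 3
    \<Longrightarrow> L x = 0"
begin

abbreviation L3 where "L3 x y z \<equiv> L (pure_tensor [x, y, z])"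

lemma zero_in_dual: "0 \<in> dual_space sA"
  by (simp add: dual_space_iff[OF vector_space_axioms])

lemma L3_linear:
  fixes B defines "B \<equiv> UNIV \<times> dual_space sA"
  shows "\<lbrakk>y \<in> B; z \<in> B\<rbrakk> \<Longrightarrow> linear_form_on (sum_scale sA dual_scale) B (\<lambda>x. L3 x y z)"
    and "\<lbrakk>x \<in> B; z \<in> B\<rbrakk> \<Longrightarrow> linear_form_on (sum_scale sA dual_scale) B (\<lambda>y. L3 x y z)"
    and "\<lbrakk>x \<in> B; y \<in> B\<rbrakk> \<Longrightarrow> linear_form_on (sum_scale sA dual_scale) B (\<lambda>z. L3 x y z)"
proof -
  note form = linear_form_on_pure_tensor[OF L.linear_axioms annihilates, folded B_def]
  show "linear_form_on (sum_scale sA dual_scale) B (\<lambda>x. L3 x y z)" if "y \<in> B" "z \<in> B"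
    using form[where us = "[]" and vs = "[y, z]"] that by simp
  show "linear_form_on (sum_scale sA dual_scale) B (\<lambda>y. L3 x y z)" if "x \<in> B" "z \<in> B"
    using form[where us = "[x]" and vs = "[z]"] that by simp
  show "linear_form_on (sum_scale sA dual_scale) B (\<lambda>z. L3 x y z)" if "x \<in> B" "y \<in> B"
    using form[where us = "[x, y]" and vs = "[]"] that by simp
qed

lemma linear_form_on_components:
  assumes "linear_form_on (sum_scale sA dual_scale) (UNIV \<times> dual_space sA) h"
  shows "linear_form_on sA UNIV (\<lambda>a. h (a, 0))"
    and "linear_form_on dual_scale (dual_space sA) (\<lambda>f. h (0, f))"
proof -
  have h: "h (x + y) = h x + h y" "h (sum_scale sA dual_scale c x) = c * h x"
    if "x \<in> UNIV \<times> dual_space sA" "y \<in> UNIV \<times> dual_space sA" for x y c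
    using assms that unfolding linear_form_on_def by blast+
  have "dual_scale c 0 = (0 :: 'a \<Rightarrow> 'k)" for c
    by (auto simp: dual_scale_def)
  then show "linear_form_on sA UNIV (\<lambda>a. h (a, 0))"
    using h(1)[of "(_, 0)" "(_, 0)"] h(2)[of "(_, 0)" 0] zero_in_dual
    by (simp add: linear_form_on_def sum_scale_apply zero_prod_def)
  show "linear_form_on dual_scale (dual_space sA) (\<lambda>f. h (0, f))"
    using h(1)[of "(0, _)" "(0, _)"] h(2)[of "(0, _)" 0] zero_in_dual
    by (simp add: linear_form_on_def sum_scale_apply zero_prod_def)
qed

lemma trilinear_L3:
  "trilinear (\<lambda>a f g. L3 (a, 0) (0, f) (0, g))"
  "trilinear (\<lambda>a f g. L3 (0, f) (a, 0) (0, g))"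
  "trilinear (\<lambda>a f g. L3 (0, f) (0, g) (a, 0))"
  using zero_in_dual
  by (simp_all add: trilinear_def linear_form_on_components[OF L3_linear(1)]
      linear_form_on_components[OF L3_linear(2)] linear_form_on_components[OF L3_linear(3)])

end

section \<open>The Yang-Baxter equation\<close>

lemma (in dual_bases) trilinear_simps:
  assumes "trilinear G" "f \<in> dual_space sA" "g \<in> dual_space sA"
  shows "G (a + b) f g = G a f g + G b f g" "G (a - b) f g = G a f g - G b f g"
    "h \<in> dual_space sA \<Longrightarrow> G a (f + h) g = G a f g + G a h g"
    "G a (- f) g = - G a f g"
    "h \<in> dual_space sA \<Longrightarrow> G a f (g + h) = G a f g + G a f h"
    "G a f (- g) = - G a f g"
proof -
  interpret D: fd_space dual_scale "dual_space sA"
    by (rule fd_space_dual)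
  have 1: "linear_form_on sA UNIV (\<lambda>a. G a f g)"
    and 2: "linear_form_on dual_scale (dual_space sA) (\<lambda>f. G a f g)"
    and 3: "linear_form_on dual_scale (dual_space sA) (\<lambda>g. G a f g)"
    using assms by (auto simp: trilinear_def)
  note 1 = linear_form_on_simps[OF 1 subspace_UNIV]
    and 2 = D.linear_form_on_simps[OF 2 D.subspace_carrier]
    and 3 = D.linear_form_on_simps[OF 3 D.subspace_carrier]
  show "G (a + b) f g = G a f g + G b f g" "G (a - b) f g = G a f g - G b f g"
    "h \<in> dual_space sA \<Longrightarrow> G a (f + h) g = G a f g + G a h g"
    "G a (- f) g = - G a f g"
    "h \<in> dual_space sA \<Longrightarrow> G a f (g + h) = G a f g + G a f h"
    "G a f (- g) = - G a f g"
    using assms 1 2 3 by simp_all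
qed


text \<open>
  The product and, below, the bracket of the semi-direct product of \<open>A\<close> with the dual of its regular
  representation.
\<close>

definition coadjoint_circ ::
  "('a \<Rightarrow> 'a \<Rightarrow> 'a) \<Rightarrow> ('a \<Rightarrow> 'a \<Rightarrow> 'a::ab_group_add) \<Rightarrow> 'a \<times> ('a \<Rightarrow> 'k::field_char_0) \<Rightarrow> 'a \<times> ('a \<Rightarrow> 'k)
    \<Rightarrow> 'a \<times> ('a \<Rightarrow> 'k)"
where
  "coadjoint_circ lhd rhd = semidirect_circ (assoc_circ lhd rhd)
      (dual_action (left_mult rhd) + dual_action (right_mult lhd)) (- dual_action (right_mult lhd))"

definition coadjoint_bracket ::
  "('a \<Rightarrow> 'a \<Rightarrow> 'a::ab_group_add) \<Rightarrow> 'a \<times> ('a \<Rightarrow> 'k::field_char_0) \<Rightarrow> 'a \<times> ('a \<Rightarrow> 'k) \<Rightarrow> 'a \<times> ('a \<Rightarrow> 'k)"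
where
  "coadjoint_bracket dia = semidirect_bracket (assoc_bracket dia) (dual_action (left_mult dia))"

locale pre_GD_dual_bases = pre_GD_algebra sA UNIV lhd rhd dia + dual_bases sA I e e'
  for sA :: "'k::field_char_0 \<Rightarrow> 'a::ab_group_add \<Rightarrow> 'a"
    and lhd (infixl \<open>\<lhd>\<close> 70) and rhd (infixl \<open>\<rhd>\<close> 70) and dia (infixl \<open>\<diamondop>\<close> 70)
    and I :: "'i set" and e e'
begin

sublocale GD_representation sA "assoc_circ lhd rhd" "assoc_bracket dia"
  sA "left_mult rhd" "right_mult lhd" "left_mult dia"
  by (rule GD_representation_pre_GD) unfold_locales

lemma dual_action_closed:
  assumes "f \<in> dual_space sA"
  shows "dual_action (left_mult rhd) a f \<in> dual_space sA"
    "dual_action (right_mult lhd) a f \<in> dual_space sA"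
    "dual_action (left_mult dia) a f \<in> dual_space sA"
  using assms linear_l linear_r linear_\<rho> action_on_dual_action[OF _ lhd.vector_space_axioms]
  by (auto simp: action_on_def)

lemma dual_action_zero:
  "dual_action \<phi> a 0 = (0 :: 'a \<Rightarrow> 'k)"
  "f \<in> dual_space sA \<Longrightarrow> dual_action (left_mult rhd) 0 f = 0"
  "f \<in> dual_space sA \<Longrightarrow> dual_action (right_mult lhd) 0 f = 0"
  "f \<in> dual_space sA \<Longrightarrow> dual_action (left_mult dia) 0 f = 0"
  by (auto simp: dual_action_def linear_action_simps[OF linear_l] linear_action_simps[OF linear_r]
      linear_action_simps[OF linear_\<rho>] dual_space_simps)

lemma mult_zero:
  "a \<lhd> 0 = 0" "0 \<lhd> a = 0" "a \<rhd> 0 = 0" "0 \<rhd> a = 0" "a \<diamondop> 0 = 0" "0 \<diamondop> a = 0"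
  using linear_action_simps(5,10)[OF linear_l] linear_action_simps(5,10)[OF linear_r]
    linear_action_simps(5,10)[OF linear_\<rho>]
  by (simp_all add: left_mult_def right_mult_def)

lemma coadjoint_circ_simps:
  fixes f g :: "'a \<Rightarrow> 'k"
  shows "coadjoint_circ lhd rhd (a, 0 :: 'a \<Rightarrow> 'k) (b, 0) = (a \<lhd> b + a \<rhd> b, 0)"
    "f \<in> dual_space sA \<Longrightarrow> coadjoint_circ lhd rhd (a, 0) (0, f)
      = (0, dual_action (left_mult rhd) a f + dual_action (right_mult lhd) a f)"
    "f \<in> dual_space sA \<Longrightarrow> coadjoint_circ lhd rhd (0, f) (a, 0) = (0, - dual_action (right_mult lhd) a f)"
    "f \<in> dual_space sA \<Longrightarrow> g \<in> dual_space sA \<Longrightarrow> coadjoint_circ lhd rhd (0, f) (0, g) = 0"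
  by (simp_all add: coadjoint_circ_def semidirect_circ_def assoc_circ_def dual_action_zero mult_zero
      zero_prod_def)

lemma coadjoint_bracket_simps:
  fixes f g :: "'a \<Rightarrow> 'k"
  shows "coadjoint_bracket dia (a, 0 :: 'a \<Rightarrow> 'k) (b, 0) = (a \<diamondop> b - b \<diamondop> a, 0)"
    "f \<in> dual_space sA \<Longrightarrow> coadjoint_bracket dia (a, 0) (0, f) = (0, dual_action (left_mult dia) a f)"
    "f \<in> dual_space sA \<Longrightarrow> coadjoint_bracket dia (0, f) (a, 0) = (0, - dual_action (left_mult dia) a f)"
    "f \<in> dual_space sA \<Longrightarrow> g \<in> dual_space sA \<Longrightarrow> coadjoint_bracket dia (0, f) (0, g) = 0"
  by (simp_all add: coadjoint_bracket_def semidirect_bracket_def assoc_bracket_def dual_action_zero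
      mult_zero zero_prod_def)

end

locale pre_GD_tensor_form = pre_GD_dual_bases sA lhd rhd dia I e e' + trilinear_tensor_form sA I e e' L
  for sA :: "'k::field_char_0 \<Rightarrow> 'a::ab_group_add \<Rightarrow> 'a"
    and lhd (infixl \<open>\<lhd>\<close> 70) and rhd (infixl \<open>\<rhd>\<close> 70) and dia (infixl \<open>\<diamondop>\<close> 70)
    and I :: "'i set" and e e' and L
begin

text \<open>
  Two vectors of \<open>A\<close> and two covectors enter each term of the equation for the canonical tensor, and
  two of the four are multiplied. A product of two vectors is a vector, a product of a vector and a
  covector is a covector, and a product of two covectors vanishes. So one vector and two covectors
  remain in every nonzero term; the three functions separate the terms by the slot of the vector.
\<close>

definition slot1 where "slot1 a f g = L3 (a, 0) (0, f) (0, g)"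
definition slot2 where "slot2 a f g = L3 (0, f) (a, 0) (0, g)"
definition slot3 where "slot3 a f g = L3 (0, f) (0, g) (a, 0)"

lemma trilinear_slots: "trilinear slot1" "trilinear slot2" "trilinear slot3"
  unfolding slot1_def[abs_def] slot2_def[abs_def] slot3_def[abs_def] by (fact trilinear_L3)+

lemmas slot_simps = trilinear_slots[THEN trilinear_simps(1)] trilinear_slots[THEN trilinear_simps(2)]
  trilinear_slots[THEN trilinear_simps(3)] trilinear_slots[THEN trilinear_simps(4)]
  trilinear_slots[THEN trilinear_simps(5)] trilinear_slots[THEN trilinear_simps(6)]

lemmas slot_shift = trilinear_slots[THEN double_trace_shift(1)] trilinear_slots[THEN double_trace_shift(2)]
  trilinear_slots[THEN double_trace_shift(3)] trilinear_slots[THEN double_trace_shift(4)]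

lemma L3_zero:
  assumes "x \<in> UNIV \<times> dual_space sA" "y \<in> UNIV \<times> dual_space sA"
  shows "L3 0 x y = 0" "L3 x 0 y = 0" "L3 x y 0 = 0"
proof -
  interpret D: fd_space "sum_scale sA dual_scale" "UNIV \<times> dual_space sA"
    by (rule fd_space_sum_scale[OF _ fd_space_dual]) unfold_locales
  note zero = D.linear_form_on_simps(5)[OF _ D.subspace_carrier]
  show "L3 0 x y = 0" "L3 x 0 y = 0" "L3 x y 0 = 0"
    using zero[OF L3_linear(1)] zero[OF L3_linear(2)] zero[OF L3_linear(3)] assms by simp_all
qed

lemma L3_slots:
  "L3 (a, 0) (0, f) (0, g) = slot1 a f g" "L3 (0, f) (a, 0) (0, g) = slot2 a f g"
  "L3 (0, f) (0, g) (a, 0) = slot3 a f g"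
  by (simp_all add: slot1_def slot2_def slot3_def)

lemma swap_indices:
  "(\<Sum>\<alpha>\<in>I. \<Sum>\<beta>\<in>I. G (m (e \<alpha>) (e \<beta>)) (e' \<beta>) (e' \<alpha>))
    = (\<Sum>\<alpha>\<in>I. \<Sum>\<beta>\<in>I. G (m (e \<beta>) (e \<alpha>)) (e' \<alpha>) (e' \<beta>))"
  by (rule sum.swap)

text \<open>
  Write \<open>l\<close> and \<open>r\<close> for the dual actions of \<open>L\<^sub>\<rhd>\<close> and \<open>R\<^sub>\<lhd>\<close>. Products with a covector on the
  right are \<open>l + r\<close>, on the left \<open>- r\<close>, hence the symmetrised product is \<open>l\<close>. Shifting \<open>l\<close> and \<open>r\<close> from
  the covectors to the basis vectors turns these terms into \<open>\<rhd>\<close>- and \<open>\<lhd>\<close>-products of basis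
  vectors. In the first and the third slot they cancel the term with \<open>\<circ> = \<lhd> + \<rhd>\<close>, in the second
  slot the one with the symmetrised product of two basis vectors.
\<close>

lemma form_GDYB_N: "L (GDYB_N (coadjoint_circ lhd rhd) canonical_skew_tensor) = 0"
proof -
  let ?l = "dual_action (left_mult rhd)" and ?r = "dual_action (right_mult lhd)"
  have "L (GDYB_N (coadjoint_circ lhd rhd) canonical_skew_tensor) = (\<Sum>\<alpha>\<in>I. \<Sum>\<beta>\<in>I.
      (slot1 (e \<alpha>) (?l (e \<beta>) (e' \<alpha>)) (e' \<beta>)
        + (slot1 (e \<alpha> \<lhd> e \<beta>) (e' \<beta>) (e' \<alpha>) + slot1 (e \<alpha> \<rhd> e \<beta>) (e' \<beta>) (e' \<alpha>))
        + slot1 (e \<alpha>) (e' \<beta>) (?r (e \<beta>) (e' \<alpha>)))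
      - (slot2 (e \<beta>) (?l (e \<alpha>) (e' \<beta>)) (e' \<alpha>) + slot2 (e \<beta>) (?r (e \<alpha>) (e' \<beta>)) (e' \<alpha>)
        + (slot2 (e \<beta>) (e' \<alpha>) (?l (e \<alpha>) (e' \<beta>)) + slot2 (e \<beta>) (e' \<alpha>) (?r (e \<alpha>) (e' \<beta>)))
        + (slot2 (e \<alpha> \<lhd> e \<beta>) (e' \<alpha>) (e' \<beta>) + slot2 (e \<alpha> \<rhd> e \<beta>) (e' \<alpha>) (e' \<beta>)
          + slot2 (e \<beta> \<lhd> e \<alpha>) (e' \<alpha>) (e' \<beta>) + slot2 (e \<beta> \<rhd> e \<alpha>) (e' \<alpha>) (e' \<beta>)))
      + (slot3 (e \<alpha>) (?r (e \<beta>) (e' \<alpha>)) (e' \<beta>) + slot3 (e \<beta>) (e' \<alpha>) (?l (e \<alpha>) (e' \<beta>))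
        + (slot3 (e \<alpha> \<lhd> e \<beta>) (e' \<alpha>) (e' \<beta>) + slot3 (e \<alpha> \<rhd> e \<beta>) (e' \<alpha>) (e' \<beta>))))"
    unfolding GDYB_N_def double_sum_canonical_skew_tensor L.sum L.diff L.add
    by (intro sum.cong refl)
      (simp add: coadjoint_circ_simps dual_basis zero_in_dual L3_zero L3_slots slot_simps
        dual_action_closed)
  also have "\<dots> = 0"
    \<comment> \<open>Every double sum takes the form of a slot function of a product of basis vectors and \<open>e' \<alpha>\<close>, \<open>e' \<beta>\<close>.\<close>
    unfolding sum.distrib sum_subtractf slot_shift[OF linear_l] slot_shift[OF linear_r]
      swap_indices[where m = lhd] swap_indices[where m = rhd]
    by (simp add: left_mult_def right_mult_def)
  finally show ?thesis .
qed

text \<open>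
  As for the product: in each slot, two shifted actions contribute \<open>e\<^sub>\<alpha> \<diamondop> e\<^sub>\<beta>\<close> and \<open>e\<^sub>\<beta> \<diamondop> e\<^sub>\<alpha>\<close> with
  opposite signs, and this cancels the commutator that comes from the bracket of two basis vectors.
\<close>

lemma form_GDYB_C: "L (GDYB_C (coadjoint_bracket dia) canonical_skew_tensor) = 0"
proof -
  let ?\<rho> = "dual_action (left_mult dia)"
  have "L (GDYB_C (coadjoint_bracket dia) canonical_skew_tensor) = (\<Sum>\<alpha>\<in>I. \<Sum>\<beta>\<in>I.
      (slot1 (e \<alpha> \<diamondop> e \<beta>) (e' \<alpha>) (e' \<beta>) - slot1 (e \<beta> \<diamondop> e \<alpha>) (e' \<alpha>) (e' \<beta>)
        - slot1 (e \<alpha>) (?\<rho> (e \<beta>) (e' \<alpha>)) (e' \<beta>) + slot1 (e \<alpha>) (e' \<beta>) (?\<rho> (e \<beta>) (e' \<alpha>)))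
      + (slot2 (e \<alpha>) (?\<rho> (e \<beta>) (e' \<alpha>)) (e' \<beta>) - slot2 (e \<beta>) (e' \<alpha>) (?\<rho> (e \<alpha>) (e' \<beta>))
        - (slot2 (e \<alpha> \<diamondop> e \<beta>) (e' \<alpha>) (e' \<beta>) - slot2 (e \<beta> \<diamondop> e \<alpha>) (e' \<alpha>) (e' \<beta>)))
      + (slot3 (e \<beta>) (e' \<alpha>) (?\<rho> (e \<alpha>) (e' \<beta>)) - slot3 (e \<beta>) (?\<rho> (e \<alpha>) (e' \<beta>)) (e' \<alpha>)
        + (slot3 (e \<alpha> \<diamondop> e \<beta>) (e' \<alpha>) (e' \<beta>) - slot3 (e \<beta> \<diamondop> e \<alpha>) (e' \<alpha>) (e' \<beta>))))"
    unfolding GDYB_C_def double_sum_canonical_skew_tensor L.sum L.diff L.add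
    by (intro sum.cong refl)
      (simp add: coadjoint_bracket_simps dual_basis zero_in_dual L3_zero L3_slots slot_simps
        dual_action_closed)
  also have "\<dots> = 0"
    unfolding sum.distrib sum_subtractf slot_shift[OF linear_\<rho>]
    by (simp add: left_mult_def)
  finally show ?thesis .
qed

end

theorem (in pre_GD_dual_bases) GDYBE_canonical_skew_tensor:
  "GDYBE_solution (sum_scale sA dual_scale) (UNIV \<times> dual_space sA)
    (coadjoint_circ lhd rhd) (coadjoint_bracket dia) canonical_skew_tensor"
proof -
  interpret rep: GD_representation_on sA "assoc_circ lhd rhd" "assoc_bracket dia" dual_scale
    "dual_space sA" "dual_action (left_mult rhd) + dual_action (right_mult lhd)"
    "- dual_action (right_mult lhd)" "dual_action (left_mult dia)"
    using fd_space_dual by (rule dual_representation)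
  have form: "pre_GD_tensor_form sA lhd rhd dia I e e' L"
    if "Vector_Spaces.linear tensor_scale (*) L"
      "\<And>x. x \<in> tensor_relations (sum_scale sA dual_scale) (UNIV \<times> dual_space sA) 3 \<Longrightarrow> L x = 0"
    for L
    by (intro pre_GD_tensor_form.intro trilinear_tensor_form.intro
        trilinear_tensor_form_axioms.intro pre_GD_dual_bases_axioms dual_bases_axioms that)
  note in_null = vector_space.in_span_if_annihilated[OF vector_space_tensor_scale]
  have "GDYB_N (coadjoint_circ lhd rhd) canonical_skew_tensor
      \<in> tensor_null (sum_scale sA dual_scale) (UNIV \<times> dual_space sA) 3"
    unfolding tensor_null_def by (rule in_null) (blast intro: pre_GD_tensor_form.form_GDYB_N form)
  moreover have "GDYB_C (coadjoint_bracket dia) canonical_skew_tensor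
      \<in> tensor_null (sum_scale sA dual_scale) (UNIV \<times> dual_space sA) 3"
    unfolding tensor_null_def by (rule in_null) (blast intro: pre_GD_tensor_form.form_GDYB_C form)
  ultimately show ?thesis
    using rep.GD_algebra_semidirect canonical_skew_tensor_in_tensor_rep
    by (simp add: GDYBE_solution_def coadjoint_circ_def coadjoint_bracket_def)
qed


theorem theorem3p16:
  fixes sA :: "'k::field_char_0 \<Rightarrow> 'a::ab_group_add \<Rightarrow> 'a"
    and circ bracket :: "'a \<Rightarrow> 'a \<Rightarrow> 'a"
    and sV :: "'k \<Rightarrow> 'v::ab_group_add \<Rightarrow> 'v"
    and l r \<rho> :: "'a \<Rightarrow> 'v \<Rightarrow> 'v"
    and T :: "'v \<Rightarrow> 'a"
    and lhd rhd dia :: "'a \<Rightarrow> 'a \<Rightarrow> 'a"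
    and n :: nat
    and e :: "nat \<Rightarrow> 'a"
    and e' :: "nat \<Rightarrow> 'a \<Rightarrow> 'k"
  shows
    "(GD_algebra sA UNIV circ bracket \<and> GD_representation sA circ bracket sV l r \<rho> \<and>
      O_operator sA circ bracket sV l r \<rho> T \<longrightarrow>
        pre_GD_algebra sV UNIV (\<lambda>u v. r (T v) u) (\<lambda>u v. l (T u) v) (\<lambda>u v. \<rho> (T u) v)) \<and>
     (pre_GD_algebra sA UNIV lhd rhd dia \<longrightarrow>
        O_operator sA (assoc_circ lhd rhd) (assoc_bracket dia)
          sA (left_mult rhd) (right_mult lhd) (left_mult dia) id) \<and>
     (pre_GD_algebra sA UNIV lhd rhd dia \<and>
      inj_on e {1..n} \<and> \<not> module.dependent sA (e ` {1..n}) \<and> module.span sA (e ` {1..n}) = UNIV \<and>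
      (\<forall>\<alpha>\<in>{1..n}. e' \<alpha> \<in> dual_space sA \<and> (\<forall>\<beta>\<in>{1..n}. e' \<alpha> (e \<beta>) = (if \<alpha> = \<beta> then 1 else 0))) \<longrightarrow>
        (let scale = sum_scale sA dual_scale;
             B = UNIV \<times> dual_space sA;
             t = (\<Sum>\<alpha>=1..n. pure_tensor [(e \<alpha>, 0), (0, e' \<alpha>)] - pure_tensor [(0, e' \<alpha>), (e \<alpha>, 0)])
         in skew_symmetric scale B t \<and>
            GDYBE_solution scale B
              (semidirect_circ (assoc_circ lhd rhd)
                (dual_action (left_mult rhd) + dual_action (right_mult lhd))
                (- dual_action (right_mult lhd)))
              (semidirect_bracket (assoc_bracket dia) (dual_action (left_mult dia))) t))"
proof (intro conjI impI; (elim conjE)?)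
  assume "O_operator sA circ bracket sV l r \<rho> T"
  then show "pre_GD_algebra sV UNIV (\<lambda>u v. r (T v) u) (\<lambda>u v. l (T u) v) (\<lambda>u v. \<rho> (T u) v)"
    by (rule O_operator.pre_GD_algebra_O_operator)
next
  assume "pre_GD_algebra sA UNIV lhd rhd dia"
  then show "O_operator sA (assoc_circ lhd rhd) (assoc_bracket dia)
      sA (left_mult rhd) (right_mult lhd) (left_mult dia) id"
    by (rule O_operator_id)
next
  assume pre_GD: "pre_GD_algebra sA UNIV lhd rhd dia"
    and span: "module.span sA (e ` {1..n}) = UNIV"
    and dual: "\<forall>\<alpha>\<in>{1..n}. e' \<alpha> \<in> dual_space sA \<and>
      (\<forall>\<beta>\<in>{1..n}. e' \<alpha> (e \<beta>) = (if \<alpha> = \<beta> then 1 else 0))"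
  interpret pre_GD_algebra sA UNIV lhd rhd dia by fact
  interpret pre_GD_dual_bases sA lhd rhd dia "{1..n}" e e'
    using span dual by unfold_locales simp_all
  show "let scale = sum_scale sA dual_scale;
      B = UNIV \<times> dual_space sA;
      t = (\<Sum>\<alpha>=1..n. pure_tensor [(e \<alpha>, 0), (0, e' \<alpha>)] - pure_tensor [(0, e' \<alpha>), (e \<alpha>, 0)])
    in skew_symmetric scale B t \<and>
      GDYBE_solution scale B
        (semidirect_circ (assoc_circ lhd rhd)
          (dual_action (left_mult rhd) + dual_action (right_mult lhd))
          (- dual_action (right_mult lhd)))
        (semidirect_bracket (assoc_bracket dia) (dual_action (left_mult dia))) t"
    unfolding Let_def
    using skew_symmetric_canonical_skew_tensor GDYBE_canonical_skew_tensor
    by (simp only: canonical_skew_tensor_def coadjoint_circ_def coadjoint_bracket_def)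
qed

end
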